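(* Let $n$ be a positive integer. Every subgroup $\Delta$ of finite index $n$ in $\pi_1(\mathcal{G}_3)$ is isomorphic to either $\pi_1(\mathcal{G}_3)$ or $\pi_1(\mathcal{G}_1)\cong\mathbb{Z}^3$. The respective numbers of subgroups are $$(i)\quad s_{\pi_1(\mathcal{G}_3),\pi_1(\mathcal{G}_3)}(n)=\sum_{k\mid n}k\,\theta(k)-\sum_{k\mid \frac{n}{3}}k\,\theta(k),$$ $$(ii)\quad s_{\mathbb{Z}^3,\pi_1(\mathcal{G}_3)}(n)=\omega\!\left(\frac{n}{3}\right).$$
   Context: $\mathcal{G}_1$ is the 3-torus, with $\pi_1(\mathcal{G}_1)\cong\mathbb{Z}^3$. $\mathcal{G}_3$ is the closed orientable flat (Euclidean) 3-manifold with $H_1(\mathcal{G}_3)=\mathbb{Z}_3\times\mathbb{Z}$; its fundamental group is $$\pi_1(\mathcal{G}_3)=\langle x,y,z : xyx^{-1}y^{-1}=1,\ zxz^{-1}=y,\ zyz^{-1}=(xy)^{-1}\rangle.$$ For groups $H,G$, $s_{H,G}(n)$ denotes the number of subgroups of index $n$ in $G$ that are isomorphic to $H$. Arithmetic functions, for a positive integer $n$: $\sigma_1(n)=\sum_{k\mid n}k$, $\omega(n)=\sum_{k\mid n}k\,\sigma_1(k)$, and $\theta(n)=\sum_{k\mid n}\left(\frac{k}{3}\right)$, where $\left(\frac{k}{3}\right)$ is the Legendre symbol ($1,-1,0$ for $k\equiv 1,2,0 \bmod 3$). All sums are over positive divisors. Each of these functions is taken to be $0$ at arguments that are not positive integers,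 and a sum over $k\mid m$ is $0$ if $m$ is not a positive integer. *)

theory Defs
  imports "HOL-Algebra.Algebra" "HOL-Number_Theory.Number_Theory"
begin

text \<open>The letter \<open>(a, True)\<close> stands for the generator \<open>a\<close> and \<open>(a, False)\<close> for its inverse.
  Every element of the type \<open>'a\<close> is a generator.\<close>

type_synonym 'a word = "('a \<times> bool) list"

definition gen :: "'a \<Rightarrow> 'a word" where
  "gen a = [(a, True)]"

definition inv_word :: "'a word \<Rightarrow> 'a word" where
  "inv_word w = rev (map (\<lambda>(a, e). (a, \<not> e)) w)"

text \<open>A pair \<open>(u, v)\<close> in \<open>R\<close> is the relation \<open>u = v\<close>. The presented group is the quotient of the
  monoid of words by the least congruence that contains \<open>R\<close> and makes \<open>(a, e)\<close> and \<open>(a, \<not> e)\<close>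
  inverse to each other; this is the quotient of the free group by the normal closure of the
  elements \<open>u v\<^sup>-\<^sup>1\<close>.\<close>

inductive pres_eq :: "('a word \<times> 'a word) set \<Rightarrow> 'a word \<Rightarrow> 'a word \<Rightarrow> bool" for R where
  refl: "pres_eq R u u"
| sym: "pres_eq R u v \<Longrightarrow> pres_eq R v u"
| trans: "pres_eq R u v \<Longrightarrow> pres_eq R v w \<Longrightarrow> pres_eq R u w"
| cong: "pres_eq R u v \<Longrightarrow> pres_eq R (p @ u @ q) (p @ v @ q)"
| cancel: "pres_eq R [(a, e), (a, \<not> e)] []"
| rel: "(u, v) \<in> R \<Longrightarrow> pres_eq R u v"

definition word_class :: "('a word \<times> 'a word) set \<Rightarrow> 'a word \<Rightarrow> 'a word set" where
  "word_class R w = {v. pres_eq R w v}"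

definition presented_group :: "('a word \<times> 'a word) set \<Rightarrow> 'a word set monoid" where
  "presented_group R =
    \<lparr>carrier = range (word_class R),
     monoid.mult = (\<lambda>A B. {w. \<exists>u\<in>A. \<exists>v\<in>B. pres_eq R (u @ v) w}),
     monoid.one = word_class R []\<rparr>"

lemma pres_eq_append:
  assumes "pres_eq R u u'" "pres_eq R v v'"
  shows "pres_eq R (u @ v) (u' @ v')"
  using pres_eq.cong[OF assms(1), of "[]" v] pres_eq.cong[OF assms(2), of u' "[]"]
  by (auto intro: pres_eq.trans)

lemma word_class_eq_iff: "word_class R u = word_class R v \<longleftrightarrow> pres_eq R u v"
  by (auto simp: word_class_def set_eq_iff intro: pres_eq.intros)

lemma mult_word_class:
  "word_class R u \<otimes>\<^bsub>presented_group R\<^esub> word_class R v = word_class R (u @ v)"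
  by (auto simp: presented_group_def word_class_def
      intro: pres_eq_append pres_eq.refl pres_eq.trans)

lemma inv_word_left: "pres_eq R (inv_word w @ w) []"
proof (induction w)
  case Nil
  then show ?case by (simp add: inv_word_def pres_eq.refl)
next
  case (Cons x w)
  obtain a e where x: "x = (a, e)" by (cases x)
  have "pres_eq R (inv_word w @ [(a, \<not> e), (a, \<not> \<not> e)] @ w) (inv_word w @ [] @ w)"
    by (rule pres_eq.cong[OF pres_eq.cancel])
  with Cons.IH show ?case
    by (auto simp: inv_word_def x intro: pres_eq.trans)
qed

lemma group_presented_group: "group (presented_group R)"
proof (rule groupI)
  let ?G = "presented_group R"
  have carr: "carrier ?G = range (word_class R)" and one: "\<one>\<^bsub>?G\<^esub> = word_class R []"
    by (simp_all add: presented_group_def)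
  show "\<one>\<^bsub>?G\<^esub> \<in> carrier ?G" by (simp add: carr one)
  show "x \<otimes>\<^bsub>?G\<^esub> y \<in> carrier ?G" if "x \<in> carrier ?G" "y \<in> carrier ?G" for x y
    using that by (auto simp: carr mult_word_class)
  show "x \<otimes>\<^bsub>?G\<^esub> y \<otimes>\<^bsub>?G\<^esub> z = x \<otimes>\<^bsub>?G\<^esub> (y \<otimes>\<^bsub>?G\<^esub> z)"
    if "x \<in> carrier ?G" "y \<in> carrier ?G" "z \<in> carrier ?G" for x y z
    using that by (auto simp: carr mult_word_class)
  show "\<one>\<^bsub>?G\<^esub> \<otimes>\<^bsub>?G\<^esub> x = x" if "x \<in> carrier ?G" for x
    using that by (auto simp: carr one mult_word_class)
  show "\<exists>y\<in>carrier ?G. y \<otimes>\<^bsub>?G\<^esub> x = \<one>\<^bsub>?G\<^esub>" if "x \<in> carrier ?G" for x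
  proof -
    from that obtain w where "x = word_class R w" by (auto simp: carr)
    then have "word_class R (inv_word w) \<otimes>\<^bsub>?G\<^esub> x = \<one>\<^bsub>?G\<^esub>"
      by (simp add: one mult_word_class word_class_eq_iff inv_word_left)
    then show ?thesis by (auto simp: carr)
  qed
qed

datatype xyz = Gen_x | Gen_y | Gen_z

text \<open>The fundamental group of the closed orientable flat 3-manifold with first homology
  \<open>\<int>\<^sub>3 \<times> \<int>\<close>, given by its standard presentation.\<close>

definition pi1_G3 :: "xyz word set monoid" where
  "pi1_G3 = (let x = gen Gen_x; y = gen Gen_y; z = gen Gen_z in
    presented_group
     {(x @ y @ inv_word x @ inv_word y, []),
      (z @ x @ inv_word z, y),
      (z @ y @ inv_word z, inv_word (x @ y))})"

text \<open>The fundamental group of the 3-torus.\<close>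

definition Z_cubed :: "(int \<times> int \<times> int) monoid" where
  "Z_cubed = integer_group \<times>\<times> integer_group \<times>\<times> integer_group"

text \<open>Finiteness is explicit since \<open>card\<close> of an infinite set is 0.\<close>

definition has_index :: "('a, 'b) monoid_scheme \<Rightarrow> 'a set \<Rightarrow> nat \<Rightarrow> bool" where
  "has_index G K n \<longleftrightarrow> finite (rcosets\<^bsub>G\<^esub> K) \<and> card (rcosets\<^bsub>G\<^esub> K) = n"

definition iso_subgroups ::
    "('c, 'd) monoid_scheme \<Rightarrow> ('a, 'b) monoid_scheme \<Rightarrow> nat \<Rightarrow> 'a set set" where
  "iso_subgroups H G n = {K. subgroup K G \<and> has_index G K n \<and> G\<lparr>carrier := K\<rparr> \<cong> H}"

definition subgroup_count :: "('c, 'd) monoid_scheme \<Rightarrow> ('a, 'b) monoid_scheme \<Rightarrow> nat \<Rightarrow> nat" where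
  "subgroup_count H G n = card (iso_subgroups H G n)"

text \<open>The arguments are rational so that \<open>n / 3\<close> is meaningful. The set of divisors is empty
  unless \<open>q\<close> is a positive integer, so sums over it then vanish.\<close>

definition divs :: "rat \<Rightarrow> nat set" where
  "divs q = {k. k > 0 \<and> (\<exists>m::nat. m > 0 \<and> q = of_nat (k * m))}"

definition sigma1 :: "rat \<Rightarrow> int" where
  "sigma1 q = (\<Sum>k\<in>divs q. int k)"

definition omega :: "rat \<Rightarrow> int" where
  "omega q = (\<Sum>k\<in>divs q. int k * sigma1 (of_nat k))"

definition theta :: "rat \<Rightarrow> int" where
  "theta q = (\<Sum>k\<in>divs q. Legendre (int k) 3)"

lemma divs_of_nat: "n > 0 \<Longrightarrow> divs (of_nat n) = {k. k dvd n}"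
  by (auto simp: divs_def dvd_def simp flip: of_nat_mult intro: Nat.gr0I)

lemma divs_div_3: "n > 0 \<Longrightarrow> divs (of_nat n / 3) = {k. 3 * k dvd n}"
proof -
  assume n: "n > 0"
  have eq: "rat_of_nat n / 3 = of_nat (k * m) \<longleftrightarrow> n = 3 * k * m" for k m
  proof -
    have "rat_of_nat n / 3 = of_nat (k * m) \<longleftrightarrow> rat_of_nat n = of_nat (3 * k * m)"
      by (simp add: field_simps)
    then show ?thesis by (simp only: of_nat_eq_iff)
  qed
  show ?thesis
    using n unfolding divs_def eq by (auto simp: dvd_def intro: Nat.gr0I)
qed

lemma Legendre_3:
  "Legendre k 3 = (if k mod 3 = 1 then 1 else if k mod 3 = 2 then -1 else 0)"
proof -
  have sq: "y\<^sup>2 mod 3 = 0 \<or> y\<^sup>2 mod 3 = 1" for y :: int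
  proof -
    have "y mod 3 = 0 \<or> y mod 3 = 1 \<or> y mod 3 = 2" by presburger
    moreover have "y\<^sup>2 mod 3 = (y mod 3)\<^sup>2 mod 3" by (simp add: power_mod)
    ultimately show ?thesis by auto
  qed
  have "QuadRes 3 k" if "k mod 3 = 1"
    using that unfolding QuadRes_def cong_def by (intro exI[of _ 1]) simp
  moreover have "\<not> QuadRes 3 k" if "k mod 3 = 2"
    using that sq unfolding QuadRes_def cong_def by (metis one_neq_zero numeral_eq_one_iff
        num.distinct(1) zero_neq_numeral)
  moreover have "k mod 3 = 0 \<or> k mod 3 = 1 \<or> k mod 3 = 2" by presburger
  ultimately show ?thesis
    by (auto simp: Legendre_def cong_def)
qed

end

(* Write pi_1(G_3) as the semidirect product of Z[zeta] and Z, with zeta a primitive cube root of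
   unity and z acting on Z[zeta] by multiplication with zeta. A subgroup K of finite index is
   determined by the lattice L of its translations, the generator k > 0 of its projection to Z and
   the class of v modulo L for any (v, k) in K; its index is k [Z[zeta] : L].
   If 3 divides k, every L of index m occurs and K is abelian, isomorphic to Z^3; there are
   sigma_1(m) lattices and m classes v for each.
   Otherwise L must be an ideal of Z[zeta]. It is principal, so K is isomorphic to the whole group.
   An ideal of norm m is d times a primitive one, of norm a with m = d^2 a, and the primitive ideals
   of norm a correspond to the roots of b^2 - b + 1 modulo a. Both the resulting count and theta are
   multiplicative, and they agree on prime powers. *)

theory Submission
  imports Defs "HOL-Computational_Algebra.Nth_Powers"
begin

section \<open>Multiplicative functions and the roots of \<open>b\<^sup>2 - b + 1\<close>\<close>

text \<open>The dichotomy comes from the elements of K over multiples of k: they act on L by powers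
  of zeta^k. This is no restriction on L if 3 divides k, and it amounts to stability under zeta
  otherwise. If k is 2 modulo 3, the action is by zeta^2, the complex conjugate of zeta, so the
  isomorphism from the whole group onto K has to conjugate Z[zeta] before multiplying by a generator
  of L. The polynomial b^2 - b + 1 is the norm of b + zeta. It appears because zeta (b + zeta) = (b
  - 1)(b + zeta) - (b^2 - b + 1), so the lattice spanned by a and b + zeta is an ideal exactly if a
  divides this norm. Since k = n / m, the condition that 3 does not divide k says that 3 m does not
  divide n; this is the origin of the subtracted sum. The two families cannot overlap because Z^3 is
  abelian and the whole group is not. On prime powers the comparison rests on one formula: with L
  the Legendre symbol of p, there are L^j + L^(j+1) roots modulo p^(j+1). Adding these over
  exponents of one parity, as the square factors d^2 demand, produces each power of L once, which is
  theta.\<close>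

definition multiplicative :: "(nat \<Rightarrow> int) \<Rightarrow> bool" where
  "multiplicative f \<longleftrightarrow> f 1 = 1 \<and> (\<forall>a b. a > 0 \<longrightarrow> b > 0 \<longrightarrow> coprime a b \<longrightarrow> f (a * b) = f a * f b)"

definition dirichlet_conv :: "(nat \<Rightarrow> int) \<Rightarrow> (nat \<Rightarrow> int) \<Rightarrow> nat \<Rightarrow> int" where
  "dirichlet_conv f g m = (\<Sum>d | d dvd m. f d * g (m div d))"

lemma bij_betw_divisors_mult:
  fixes a b :: nat
  assumes "a > 0" "b > 0" "coprime a b"
  shows "bij_betw (\<lambda>(d, e). d * e) ({d. d dvd a} \<times> {d. d dvd b}) {d. d dvd a * b}"
proof (rule bij_betw_imageI)
  show "inj_on (\<lambda>(d, e). d * e) ({d. d dvd a} \<times> {d. d dvd b})"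
  proof (rule inj_onI, clarify)
    fix d e d' e' assume h: "d dvd a" "e dvd b" "d' dvd a" "e' dvd b" "d * e = d' * e'"
    have "coprime d e'" "coprime d' e" "coprime e d'" "coprime e' d"
      using assms(3) h coprime_divisors coprime_commute by metis+
    \<comment> \<open>\<open>d\<close> divides \<open>d' * e'\<close> and is coprime to
      \<open>e'\<close>, so it divides \<open>d'\<close>; the other three are symmetric.\<close>
    then have "d dvd d'" "d' dvd d" "e dvd e'" "e' dvd e"
      using h(5) by (metis coprime_dvd_mult_left_iff coprime_dvd_mult_right_iff dvd_triv_left dvd_triv_right)+
    then show "d = d' \<and> e = e'" by (simp add: dvd_antisym)
  qed
  show "(\<lambda>(d, e). d * e) ` ({d. d dvd a} \<times> {d. d dvd b}) = {d. d dvd a * b}"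
  proof (intro equalityI subsetI)
    fix x assume "x \<in> {d. d dvd a * b}"
    then obtain d e where "x = d * e" "d dvd a" "e dvd b"
      using division_decomp by blast
    then show "x \<in> (\<lambda>(d, e). d * e) ` ({d. d dvd a} \<times> {d. d dvd b})" by auto
  qed (auto intro: mult_dvd_mono)
qed

lemma multiplicative_dirichlet_conv:
  assumes "multiplicative f" "multiplicative g"
  shows "multiplicative (dirichlet_conv f g)"
  unfolding multiplicative_def
proof (intro conjI allI impI)
  show "dirichlet_conv f g 1 = 1"
    using assms by (simp add: dirichlet_conv_def multiplicative_def)
next
  fix a b :: nat assume ab: "a > 0" "b > 0" "coprime a b"
  have "dirichlet_conv f g (a * b) =
     (\<Sum>(d, e)\<in>{d. d dvd a} \<times> {d. d dvd b}. f (d * e) * g (a * b div (d * e)))"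
    unfolding dirichlet_conv_def
    by (subst sum.reindex_bij_betw[OF bij_betw_divisors_mult[OF ab], symmetric])
      (simp add: case_prod_unfold)
  also have "\<dots> = (\<Sum>(d, e)\<in>{d. d dvd a} \<times> {d. d dvd b}. (f d * g (a div d)) * (f e * g (b div e)))"
  proof (rule sum.cong[OF HOL.refl], clarify)
    fix d e assume de: "d dvd a" "e dvd b"
    then obtain d' e' where a: "a = d * d'" and b: "b = e * e'" by (auto elim!: dvdE)
    have pos: "d > 0" "d' > 0" "e > 0" "e' > 0" using ab a b by auto
    have cop: "coprime d e" "coprime d' e'" using ab(3) by (auto simp: a b)
    have "a * b div (d * e) = d' * e'"
      using pos by (simp add: a b mult.commute mult.left_commute)
    then show "f (d * e) * g (a * b div (d * e)) = f d * g (a div d) * (f e * g (b div e))"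
      using assms pos cop by (simp add: multiplicative_def a b)
  qed
  also have "\<dots> = dirichlet_conv f g a * dirichlet_conv f g b"
    by (simp add: dirichlet_conv_def sum_product sum.cartesian_product)
  finally show "dirichlet_conv f g (a * b) = dirichlet_conv f g a * dirichlet_conv f g b" .
qed

text \<open>Induction on \<open>m\<close>: splitting off the full power of one prime divisor leaves
  a smaller cofactor coprime to it.\<close>

lemma multiplicative_eqI:
  assumes "multiplicative f" "multiplicative g"
    and pp: "\<And>p e. Factorial_Ring.prime p \<Longrightarrow> f (p ^ e) = g (p ^ e)" and "m > 0"
  shows "f m = g m"
  using \<open>m > 0\<close>
proof (induction m rule: less_induct)
  case (less m)
  show ?case
  proof (cases "m = 1")
    case True
    then show ?thesis using assms by (simp add: multiplicative_def)
  next
    case False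
    then obtain p where p: "Factorial_Ring.prime p" "p dvd m" using prime_factor_nat by blast
    define k where "k = multiplicity p m"
    obtain y where y: "m = p ^ k * y" "\<not> p dvd y"
      unfolding k_def using less.prems p(1) by (metis multiplicity_decompose' neq0_conv not_prime_unit)
    have "y > 0" using y less.prems by (cases y) auto
    have "k > 0"
      unfolding k_def using p less.prems by (simp add: prime_multiplicity_gt_zero_iff)
    then have "1 < p ^ k"
      using prime_gt_1_nat[OF p(1)] by (intro one_less_power)
    then have "y < m" using y(1) \<open>y > 0\<close> by simp
    have cop: "coprime (p ^ k) y"
      using p y(2) by (simp add: prime_imp_coprime)
    have "f (p ^ k * y) = f (p ^ k) * f y"
      "g (p ^ k * y) = g (p ^ k) * g y"
      using assms(1,2) cop \<open>y > 0\<close> prime_gt_0_nat[OF p(1)] unfolding multiplicative_def by auto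
    then show ?thesis using less.IH[OF \<open>y < m\<close> \<open>y > 0\<close>] pp[OF p(1)] y(1) by simp
  qed
qed

lemma dirichlet_conv_prime_power:
  assumes "Factorial_Ring.prime p"
  shows "dirichlet_conv f g (p ^ e) = (\<Sum>j\<le>e. f (p ^ j) * g (p ^ (e - j)))"
proof -
  have p: "p > 1" using assms prime_gt_1_nat by blast
  have eq: "{d. d dvd p ^ e} = (\<lambda>j. p ^ j) ` {..e}"
    using divides_primepow_nat[OF assms] by auto
  have "inj_on (\<lambda>j. p ^ j) {..e}"
    using p by (auto simp: inj_on_def)
  then have "dirichlet_conv f g (p ^ e) = (\<Sum>j\<le>e. f (p ^ j) * g (p ^ e div p ^ j))"
    unfolding dirichlet_conv_def eq by (simp add: sum.reindex)
  also have "\<dots> = (\<Sum>j\<le>e. f (p ^ j) * g (p ^ (e - j)))"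
    using p by (intro sum.cong) (simp_all add: power_diff)
  finally show ?thesis .
qed

section \<open>Roots modulo prime powers\<close>

definition root_set :: "nat \<Rightarrow> int set" where
  "root_set a = {b. 0 \<le> b \<and> b < int a \<and> int a dvd b\<^sup>2 - b + 1}"

definition num_roots :: "nat \<Rightarrow> int" where
  "num_roots a = int (card (root_set a))"

lemma finite_root_set: "finite (root_set a)"
  by (rule finite_subset[of _ "{0..<int a}"]) (auto simp: root_set_def)

lemma dvd_root_poly_cong:
  fixes b c q :: int
  assumes "[b = c] (mod q)"
  shows "q dvd b\<^sup>2 - b + 1 \<longleftrightarrow> q dvd c\<^sup>2 - c + 1"
  by (intro cong_dvd_iff cong_add cong_diff cong_pow assms cong_refl)

lemma mod_mem_root_set:
  assumes "a > 0" "int a dvd b\<^sup>2 - b + 1"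
  shows "b mod int a \<in> root_set a"
  using assms dvd_root_poly_cong[of "b mod int a" b "int a"] by (simp add: root_set_def)

text \<open>The Chinese remainder theorem: reducing modulo \<open>a\<close> and modulo
  \<open>b\<close> matches the roots modulo \<open>a * b\<close> with pairs of roots.\<close>

lemma multiplicative_num_roots: "multiplicative num_roots"
  unfolding multiplicative_def
proof (intro conjI allI impI)
  have "root_set 1 = {0}" by (auto simp: root_set_def)
  then show "num_roots 1 = 1" by (simp add: num_roots_def)
next
  fix a b :: nat assume ab: "a > 0" "b > 0" "coprime a b"
  then have cop: "coprime (int a) (int b)" by simp
  let ?h = "\<lambda>x. (x mod int a, x mod int b)"
  have "bij_betw ?h (root_set (a * b)) (root_set a \<times> root_set b)"
  proof (rule bij_betw_imageI)
    show "inj_on ?h (root_set (a * b))"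
    proof (rule inj_onI)
      fix x y assume xy: "x \<in> root_set (a * b)" "y \<in> root_set (a * b)" "?h x = ?h y"
      then have "[x = y] (mod int a * int b)"
        by (intro coprime_cong_mult cop) (auto simp: cong_def)
      with xy(1,2) show "x = y" by (simp add: root_set_def cong_def)
    qed
    show "?h ` root_set (a * b) = root_set a \<times> root_set b"
    proof (intro equalityI subsetI)
      fix z assume "z \<in> ?h ` root_set (a * b)"
      then obtain x where x: "x \<in> root_set (a * b)" "z = ?h x" by auto
      then have "int a dvd x\<^sup>2 - x + 1" "int b dvd x\<^sup>2 - x + 1"
        by (auto simp: root_set_def dest: dvd_mult_left dvd_mult_right)
      with x(2) ab show "z \<in> root_set a \<times> root_set b" by (simp add: mod_mem_root_set)
    next
      fix z assume "z \<in> root_set a \<times> root_set b"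
      then obtain u v where z: "z = (u, v)" "u \<in> root_set a" "v \<in> root_set b" by auto
      obtain x where x: "[x = u] (mod int a)" "[x = v] (mod int b)"
        using binary_chinese_remainder_int[OF cop] by blast
      have "int a dvd x\<^sup>2 - x + 1" "int b dvd x\<^sup>2 - x + 1"
        using z x dvd_root_poly_cong by (auto simp: root_set_def)
      then have "int (a * b) dvd x\<^sup>2 - x + 1" using cop by (simp add: divides_mult)
      then have mem: "x mod int (a * b) \<in> root_set (a * b)" using ab by (intro mod_mem_root_set) auto
      have "?h (x mod int (a * b)) = z"
        using x z by (auto simp: root_set_def cong_def mod_mod_cancel)
      then show "z \<in> ?h ` root_set (a * b)" using image_eqI[OF HOL.sym mem, of ?h] by blast
    qed
  qed
  then show "num_roots (a * b) = num_roots a * num_roots b"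
    by (simp add: num_roots_def bij_betw_same_card card_cartesian_product)
qed

text \<open>If t is a cube root of unity modulo p^e and t - 1 is invertible, then t^3 - 1 = (t -
  1)(t^2 + t + 1) makes -t a root. Taking t directly modulo p^e replaces Hensel lifting.\<close>

lemma exists_root_prime_power:
  assumes "Factorial_Ring.prime p" "p mod 3 = 1"
  shows "\<exists>b. int (p ^ e) dvd b\<^sup>2 - b + 1"
proof (cases "e = 0")
  case False
  have p: "p > 1" using assms prime_gt_1_nat by blast
  obtain g where g: "residue_primroot p g"
    using prime_primitive_root_exists[of p] assms(1) p by auto
  then have cop: "coprime p g" and ordg: "ord p g = p - 1"
    using assms(1) by (auto simp: residue_primroot_def totient_prime)
  obtain k where k: "p - 1 = 3 * k"
    using assms(2) p by (metis dvd_def mod_eq_dvd_iff_nat less_imp_le mod_mod_trivial mod_eq_self_iff_div_eq_0 dvd_minus_mod)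
  have tot: "totient (p ^ e) = 3 * (p ^ (e - 1) * k)"
    using assms(1) False k by (simp add: totient_prime_power)
  \<comment> \<open>The exponent is a third of \<open>totient (p ^ e)\<close>, so Euler's theorem
    gives t^3 = 1. It is not a multiple of p - 1 = 3 k, the order of \<open>g\<close> modulo
    \<open>p\<close>, so t differs from 1 already modulo \<open>p\<close>.\<close>
  define t where "t = g ^ (p ^ (e - 1) * k)"
  have "[g ^ totient (p ^ e) = 1] (mod p ^ e)"
    using cop by (intro euler_theorem) (simp add: coprime_commute)
  then have t3: "[t ^ 3 = 1] (mod p ^ e)"
    by (simp add: t_def tot power_mult[symmetric] mult.commute mult.left_commute)
  have "\<not> [t = 1] (mod p)"
  proof
    assume "[t = 1] (mod p)"
    then have "3 * k dvd p ^ (e - 1) * k" unfolding t_def ord_divides ordg k .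
    then have "3 dvd p ^ (e - 1)" using k p by auto
    then have "3 dvd p" using prime_dvd_power[of 3 p "e - 1"] by simp
    then show False using assms(2) by presburger
  qed
  then have "\<not> int p dvd int t - 1"
    by (metis cong_iff_dvd_diff cong_int_iff of_nat_1)
  then have "coprime (int (p ^ e)) (int t - 1)"
    using assms(1) by (simp add: prime_imp_coprime)
  moreover have "int (p ^ e) dvd int t ^ 3 - 1"
    using t3 by (metis cong_iff_dvd_diff cong_int_iff of_nat_1 of_nat_power)
  then have "int (p ^ e) dvd (int t - 1) * ((- int t)\<^sup>2 - (- int t) + 1)"
    by (simp add: power3_eq_cube power2_eq_square algebra_simps)
  ultimately show ?thesis using coprime_dvd_mult_right_iff by blast
qed simp

text \<open>A root b makes -b a cube root of unity modulo p. Fermat's exponent p - 1 is 1 modulo 3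
  here, so -b = 1; but the polynomial takes the value 3 at -1, which would force p = 3.\<close>

lemma not_prime_dvd_root_poly:
  assumes "Factorial_Ring.prime p" "p mod 3 = 2"
  shows "\<not> int p dvd b\<^sup>2 - b + 1"
proof
  assume h: "int p dvd b\<^sup>2 - b + 1"
  have p: "p > 1" using assms prime_gt_1_nat by blast
  define t where "t = nat ((- b) mod int p)"
  have t: "[int t = - b] (mod int p)" using p by (simp add: t_def cong_def)
  have "int p dvd (- b) ^ 3 - 1"
  proof -
    have "(- b) ^ 3 - 1 = (b\<^sup>2 - b + 1) * (- b - 1)"
      by (simp add: power3_eq_cube power2_eq_square algebra_simps)
    then show ?thesis using h by simp
  qed
  then have "[(- b) ^ 3 = 1] (mod int p)" by (simp add: cong_iff_dvd_diff)
  then have "[int t ^ 3 = 1] (mod int p)" using t cong_pow cong_trans by blast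
  then have t3: "[t ^ 3 = 1] (mod p)" by (metis cong_int_iff of_nat_1 of_nat_power)
  have "coprime t p"
    using cong_imp_coprime[OF cong_sym[OF t3]] by simp
  then have "\<not> p dvd t" using assms(1) p by (metis coprime_absorb_right coprime_commute not_prime_unit)
  then have "[t ^ (p - 1) = 1] (mod p)" using fermat_theorem assms(1) by blast
  moreover define k where "k = p div 3"
  then have k: "p - 1 = 3 * k + 1" using assms(2) by presburger
  moreover have "[t ^ (3 * k + 1) = t] (mod p)"
    unfolding power_add power_mult using cong_mult[OF cong_pow[OF t3, of k] cong_refl[of t]] by simp
  ultimately have "[t = 1] (mod p)" by (metis cong_sym cong_trans)
  then have "[- b = 1] (mod int p)" using t by (metis cong_int_iff cong_sym cong_trans of_nat_1)
  then have "[b = -1] (mod int p)" using cong_minus_minus_iff by force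
  then have "int p dvd (-1)\<^sup>2 - (-1) + 1" using h dvd_root_poly_cong by blast
  then have "p dvd 3" using int_dvd_int_iff[of p 3] by simp
  then have "p = 3" using primes_dvd_imp_eq[OF assms(1), of 3] by simp
  then show False using assms(2) by simp
qed

text \<open>The roots come in pairs b, 1 - b. They differ even modulo p because (2 b - 1)^2 = 4 (b^2
  - b + 1) - 3 and p does not divide 3. For the same reason p cannot divide both factors of (x -
  b)(x + b - 1) for a further root x, so one factor is a unit and the whole prime power divides the
  other.\<close>

lemma num_roots_prime_power_1:
  assumes "Factorial_Ring.prime p" "p mod 3 = 1"
  shows "num_roots (p ^ Suc j) = 2"
proof -
  have p: "p > 1" using assms prime_gt_1_nat by blast
  define Q where "Q = p ^ Suc j"
  let ?q = "int Q"
  have Q: "Q > 0" using p by (simp add: Q_def)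
  have pQ: "int p dvd ?q" by (simp add: Q_def)
  have copQ: "coprime ?q x" if "\<not> int p dvd x" for x
    using that assms(1) by (auto simp: Q_def prime_imp_coprime simp del: power_Suc)
  obtain b0 where b0: "?q dvd b0\<^sup>2 - b0 + 1" using exists_root_prime_power[OF assms] unfolding Q_def by blast
  define b where "b = b0 mod ?q"
  have b: "b \<in> root_set Q"
    unfolding b_def using b0 Q by (intro mod_mem_root_set)
  have not2: "\<not> int p dvd 2 * b - 1"
  proof
    assume h: "int p dvd 2 * b - 1"
    have "int p dvd b\<^sup>2 - b + 1"
      using b pQ by (auto simp: root_set_def intro: dvd_trans)
    then have "int p dvd 4 * (b\<^sup>2 - b + 1) - (2 * b - 1) * (2 * b - 1)"
      by (rule dvd_diff[OF dvd_mult dvd_mult[OF h]])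
    also have "4 * (b\<^sup>2 - b + 1) - (2 * b - 1) * (2 * b - 1) = int 3"
      by (simp add: power2_eq_square algebra_simps)
    finally have "p dvd 3" by (simp only: int_dvd_int_iff)
    then have "p = 3" using primes_dvd_imp_eq[OF assms(1), of 3] by simp
    then show False using assms(2) by simp
  qed
  define c where "c = (1 - b) mod ?q"
  have c: "c \<in> root_set Q"
  proof -
    have eq: "(1 - b)\<^sup>2 - (1 - b) + 1 = b\<^sup>2 - b + 1" by (simp add: power2_eq_square algebra_simps)
    have "?q dvd (1 - b)\<^sup>2 - (1 - b) + 1" unfolding eq using b by (simp add: root_set_def)
    then show ?thesis unfolding c_def using Q by (intro mod_mem_root_set)
  qed
  have bc: "b \<noteq> c"
  proof
    assume "b = c"
    then have "[b = 1 - b] (mod ?q)" by (metis c_def cong_def mod_mod_trivial)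
    then have "?q dvd b - (1 - b)" by (simp only: cong_iff_dvd_diff)
    moreover have "b - (1 - b) = 2 * b - 1" by simp
    ultimately show False using not2 pQ dvd_trans by metis
  qed
  have "root_set Q \<subseteq> {b, c}"
  proof
    fix x assume x: "x \<in> root_set Q"
    have "?q dvd (x\<^sup>2 - x + 1) - (b\<^sup>2 - b + 1)"
      using x b by (intro dvd_diff) (auto simp: root_set_def)
    also have "(x\<^sup>2 - x + 1) - (b\<^sup>2 - b + 1) = (x - b) * (x + b - 1)"
      by (simp add: power2_eq_square algebra_simps)
    finally have d: "?q dvd (x - b) * (x + b - 1)" .
    have "\<not> int p dvd x - b \<or> \<not> int p dvd x + b - 1"
    proof (rule ccontr)
      assume "\<not> ?thesis"
      then have "int p dvd (x + b - 1) - (x - b)" using dvd_diff by blast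
      then show False using not2 by (simp add: algebra_simps)
    qed
    then have "coprime ?q (x - b) \<or> coprime ?q (x + b - 1)"
      using copQ by blast
    then have "?q dvd x - b \<or> ?q dvd x + b - 1"
      using d coprime_dvd_mult_right_iff coprime_dvd_mult_left_iff by blast
    then show "x \<in> {b, c}"
    proof
      assume "?q dvd x - b"
      then have "[x = b] (mod ?q)" by (simp only: cong_iff_dvd_diff)
      then show ?thesis using x b by (simp add: root_set_def cong_def)
    next
      assume "?q dvd x + b - 1"
      then have "[x = 1 - b] (mod ?q)" by (simp add: cong_iff_dvd_diff algebra_simps)
      then show ?thesis using x by (simp add: root_set_def cong_def c_def)
    qed
  qed
  then have "root_set Q = {b, c}" using b c by blast
  with bc show ?thesis unfolding num_roots_def Q_def[symmetric] by simp
qed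

lemma num_roots_prime_power_2:
  assumes "Factorial_Ring.prime p" "p mod 3 = 2"
  shows "num_roots (p ^ Suc j) = 0"
proof -
  have "root_set (p ^ Suc j) = {}"
    using not_prime_dvd_root_poly[OF assms] by (auto simp: root_set_def dest: dvd_mult_left)
  then show ?thesis by (simp add: num_roots_def)
qed

lemma num_roots_3: "num_roots 3 = 1"
proof -
  have "b = 2" if "b \<in> root_set 3" for b
  proof -
    have "b = 0 \<or> b = 1 \<or> b = 2" using that by (auto simp: root_set_def)
    then show ?thesis using that by (auto simp: root_set_def)
  qed
  moreover have "2 \<in> root_set 3" by (simp add: root_set_def)
  ultimately have "root_set 3 = {2}" by blast
  then show ?thesis by (simp add: num_roots_def)
qed

text \<open>Completing the square: four times the value is (2 b - 1)^2 + 3, and a square divisible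
  by 3 is divisible by 9.\<close>

lemma not_9_dvd_root_poly: "\<not> (9::int) dvd b\<^sup>2 - b + 1"
proof
  assume h: "9 dvd b\<^sup>2 - b + 1"
  have "4 * (b\<^sup>2 - b + 1) = (2 * b - 1)\<^sup>2 + 3" by (simp add: power2_eq_square algebra_simps)
  with h have s: "9 dvd (2 * b - 1)\<^sup>2 + 3" by (metis dvd_mult)
  then have "3 dvd (2 * b - 1)\<^sup>2" by presburger
  then have "3 dvd 2 * b - 1" using prime_dvd_power[of "3::int"] by simp
  then have "3\<^sup>2 dvd (2 * b - 1)\<^sup>2" by (rule dvd_power_same)
  then have "9 dvd (2 * b - 1)\<^sup>2" by simp
  then have "(9::int) dvd 3" using s dvd_add_right_iff by blast
  then show False by simp
qed

lemma num_roots_power_of_3: "num_roots (3 ^ Suc (Suc j)) = 0"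
proof -
  have "(9::int) dvd int (3 ^ Suc (Suc j))" by simp
  then have "root_set (3 ^ Suc (Suc j)) = {}"
    unfolding root_set_def using not_9_dvd_root_poly dvd_trans by blast
  then show ?thesis by (simp add: num_roots_def)
qed

text \<open>Written as L^j + L^(j+1), one formula covers all three residue classes of p. At p = 3
  the symbol is 0, and \<open>0 ^ 0 = 1\<close> supplies the single root modulo 3.\<close>

lemma num_roots_prime_power:
  assumes "Factorial_Ring.prime p"
  shows "num_roots (p ^ Suc j) = Legendre (int p) 3 ^ j * (Legendre (int p) 3 + 1)"
proof -
  have "p mod 3 = 0 \<or> p mod 3 = 1 \<or> p mod 3 = 2" by presburger
  then consider "p mod 3 = 1" | "p mod 3 = 2" | "p mod 3 = 0" by argo
  then show ?thesis
  proof cases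
    case 1
    then have "int p mod 3 = 1" by presburger
    with 1 show ?thesis unfolding num_roots_prime_power_1[OF assms 1] by (simp add: Legendre_3)
  next
    case 2
    then have "int p mod 3 = 2" by presburger
    with 2 show ?thesis unfolding num_roots_prime_power_2[OF assms 2] by (simp add: Legendre_3)
  next
    case 3
    then have "p = 3" using primes_dvd_imp_eq[of 3 p] assms by (simp add: mod_eq_0_iff_dvd)
    then show ?thesis
      using num_roots_3 num_roots_power_of_3 by (cases j) (simp_all add: Legendre_3)
  qed
qed

lemma Legendre_3_mult: "Legendre (a * b) 3 = Legendre a 3 * Legendre b 3"
proof -
  have "a mod 3 = 0 \<or> a mod 3 = 1 \<or> a mod 3 = 2" "b mod 3 = 0 \<or> b mod 3 = 1 \<or> b mod 3 = 2"
    by presburger+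
  moreover have "a * b mod 3 = (a mod 3) * (b mod 3) mod 3" by (simp add: mod_mult_eq)
  ultimately show ?thesis
    unfolding Legendre_3 by (elim disjE) (simp_all only:, simp_all)
qed

lemma Legendre_3_power: "Legendre (a ^ j) 3 = Legendre a 3 ^ j"
  by (induction j) (simp_all add: Legendre_3_mult, simp add: Legendre_3)

section \<open>Matching the root count with theta\<close>

text \<open>Convolution with this function accounts for the factor \<open>d\<^sup>2\<close> by which
  the norm of an ideal exceeds the norm of its primitive part.\<close>

definition square_ind :: "nat \<Rightarrow> int" where
  "square_ind m = of_bool (is_square m)"

text \<open>The term with exponent j > 0 contributes the two adjacent powers L^(j-1) and L^j, so the
  terms with e - j even tile the exponents from 0 to e. Hence the induction in steps of two.\<close>

lemma sum_num_roots_prime_power: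
  assumes "Factorial_Ring.prime p"
  shows "(\<Sum>j\<le>e. num_roots (p ^ j) * of_bool (even (e - j))) = (\<Sum>j\<le>e. Legendre (int p) 3 ^ j)"
proof (induction e rule: nat_induct2)
  case 0
  show ?case using multiplicative_num_roots by (simp add: multiplicative_def)
next
  case 1
  have "{..1::nat} = {0, 1}" by auto
  then show ?case using num_roots_prime_power[OF assms, of 0] by simp
next
  case (step e)
  let ?r = "\<lambda>j. num_roots (p ^ j)"
  have "(\<Sum>j\<le>e. ?r j * of_bool (even (Suc (Suc e) - j))) = (\<Sum>j\<le>e. ?r j * of_bool (even (e - j)))"
    by (intro sum.cong) (auto simp: Suc_diff_le)
  then have "(\<Sum>j\<le>Suc (Suc e). ?r j * of_bool (even (Suc (Suc e) - j))) =
      (\<Sum>j\<le>e. ?r j * of_bool (even (e - j))) + ?r (Suc (Suc e))"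
    by (simp del: power_Suc)
  also have "\<dots> = (\<Sum>j\<le>Suc (Suc e). Legendre (int p) 3 ^ j)"
    unfolding step num_roots_prime_power[OF assms] by (simp add: algebra_simps)
  finally show ?case by simp
qed

lemma dirichlet_conv_num_roots_square:
  assumes "m > 0"
  shows "dirichlet_conv num_roots square_ind m = (\<Sum>d | d dvd m. Legendre (int d) 3)"
proof -
  let ?L = "\<lambda>d. Legendre (int d) 3"
  have mL: "multiplicative ?L"
    by (simp add: multiplicative_def Legendre_3_mult) (simp add: Legendre_3)
  have m1: "multiplicative (\<lambda>_. 1)" by (simp add: multiplicative_def)
  have ms: "multiplicative square_ind"
    by (auto simp: multiplicative_def square_ind_def is_nth_power_mult_coprime_nat_iff)
  have "dirichlet_conv num_roots square_ind m = dirichlet_conv ?L (\<lambda>_. 1) m"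
  proof (rule multiplicative_eqI[OF _ _ _ assms])
    fix p e :: nat assume p: "Factorial_Ring.prime p"
    show "dirichlet_conv num_roots square_ind (p ^ e) = dirichlet_conv ?L (\<lambda>_. 1) (p ^ e)"
      unfolding dirichlet_conv_prime_power[OF p]
      using sum_num_roots_prime_power[OF p, of e]
      by (simp add: square_ind_def is_nth_power_prime_power_nat_iff p Legendre_3_power)
  qed (intro multiplicative_dirichlet_conv mL m1 ms multiplicative_num_roots)+
  then show ?thesis by (simp add: dirichlet_conv_def)
qed

section \<open>The group as a semidirect product\<close>

datatype eis = Eis (er: int) (ei: int)

lemma eis_eq_iff: "x = y \<longleftrightarrow> er x = er y \<and> ei x = ei y"
  by (cases x; cases y) simp

instantiation eis :: comm_ring_1
begin

definition zero_eis where "0 = Eis 0 0"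
definition one_eis where "1 = Eis 1 0"
definition plus_eis where "x + y = Eis (er x + er y) (ei x + ei y)"
definition minus_eis where "x - y = Eis (er x - er y) (ei x - ei y)"
definition uminus_eis where "- x = Eis (- er x) (- ei x)"
text \<open>\<open>Eis a b\<close> stands for a + b zeta, and zeta^2 = -1 - zeta.\<close>

definition times_eis where
  "x * y = Eis (er x * er y - ei x * ei y) (er x * ei y + ei x * er y - ei x * ei y)"

instance
  by standard (simp_all add: eis_eq_iff zero_eis_def one_eis_def plus_eis_def minus_eis_def
      uminus_eis_def times_eis_def algebra_simps)

end

lemma er_simps [simp]:
  "er 0 = 0" "er 1 = 1" "er (x + y) = er x + er y" "er (x - y) = er x - er y" "er (- x) = - er x"
  "er (x * y) = er x * er y - ei x * ei y"
  by (simp_all add: zero_eis_def one_eis_def plus_eis_def minus_eis_def uminus_eis_def times_eis_def)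

lemma ei_simps [simp]:
  "ei 0 = 0" "ei 1 = 0" "ei (x + y) = ei x + ei y" "ei (x - y) = ei x - ei y" "ei (- x) = - ei x"
  "ei (x * y) = er x * ei y + ei x * er y - ei x * ei y"
  by (simp_all add: zero_eis_def one_eis_def plus_eis_def minus_eis_def uminus_eis_def times_eis_def)

lemma er_of_int [simp]: "er (of_int a) = a" and ei_of_int [simp]: "ei (of_int a) = 0"
proof -
  have "er (of_int a) = a \<and> ei (of_int a) = 0"
    by (induction a rule: int_induct[where k = 0]) simp_all
  then show "er (of_int a) = a" "ei (of_int a) = 0" by simp_all
qed

definition zeta :: eis where
  "zeta = Eis 0 1"

text \<open>Powers with integer exponent, negative ones included; as zeta has order 3 only the
  residue of the exponent matters.\<close>

definition zeta_pow :: "int \<Rightarrow> eis" where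
  "zeta_pow c = (if c mod 3 = 0 then 1 else if c mod 3 = 1 then zeta else zeta * zeta)"

lemma zeta_cube: "zeta * (zeta * zeta) = 1"
  by (simp add: eis_eq_iff zeta_def)

lemma zeta_pow_add: "zeta_pow (c + d) = zeta_pow c * zeta_pow d"
proof -
  have "c mod 3 = 0 \<or> c mod 3 = 1 \<or> c mod 3 = 2" "d mod 3 = 0 \<or> d mod 3 = 1 \<or> d mod 3 = 2"
    by presburger+
  moreover have "(c + d) mod 3 = (c mod 3 + d mod 3) mod 3" by (simp add: mod_add_eq)
  ultimately show ?thesis
    by (elim disjE) (simp_all add: zeta_pow_def zeta_cube mult.assoc)
qed

lemma zeta_pow_0 [simp]: "zeta_pow 0 = 1"
  by (simp add: zeta_pow_def)

lemma zeta_pow_1 [simp]: "zeta_pow 1 = zeta"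
  by (simp add: zeta_pow_def)

lemma zeta_pow_inverse: "zeta_pow (- c) * (zeta_pow c * u) = u" "zeta_pow c * (zeta_pow (- c) * u) = u"
  using zeta_pow_add[of "- c" c] zeta_pow_add[of c "- c"] by (simp_all flip: mult.assoc)

definition flat_model :: "(eis \<times> int) monoid" where
  "flat_model = \<lparr>carrier = UNIV, monoid.mult = (\<lambda>(u, c) (v, d). (u + zeta_pow c * v, c + d)),
     one = (0, 0)\<rparr>"

lemma carrier_flat_model [simp]: "carrier flat_model = UNIV"
  by (simp add: flat_model_def)

lemma one_flat_model [simp]: "\<one>\<^bsub>flat_model\<^esub> = (0, 0)"
  by (simp add: flat_model_def)

lemma mult_flat_model [simp]: "(u, c) \<otimes>\<^bsub>flat_model\<^esub> (v, d) = (u + zeta_pow c * v, c + d)"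
  by (simp add: flat_model_def)

lemma group_flat_model: "group flat_model"
proof (rule groupI)
  fix x y z :: "eis \<times> int"
  show "x \<otimes>\<^bsub>flat_model\<^esub> y \<otimes>\<^bsub>flat_model\<^esub> z = x \<otimes>\<^bsub>flat_model\<^esub> (y \<otimes>\<^bsub>flat_model\<^esub> z)"
    by (cases x; cases y; cases z) (simp add: zeta_pow_add algebra_simps)
  show "\<exists>y\<in>carrier flat_model. y \<otimes>\<^bsub>flat_model\<^esub> x = \<one>\<^bsub>flat_model\<^esub>"
    by (cases x) (auto intro!: exI[of _ "- (zeta_pow (- snd x) * fst x)"] exI[of _ "- snd x"])
qed auto

lemma flat_model_one_mult [simp]: "(0, 0) \<otimes>\<^bsub>flat_model\<^esub> x = x" "x \<otimes>\<^bsub>flat_model\<^esub> (0, 0) = x"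
  by (cases x; simp)+

interpretation flat: group flat_model
  by (rule group_flat_model)

lemma inv_flat_model: "inv\<^bsub>flat_model\<^esub> (u, c) = (- (zeta_pow (- c) * u), - c)"
  by (rule flat.inv_equality) auto

text \<open>A family additive in its index is a homomorphism from the integers, hence fixed by its
  value at 1. Closed forms of powers can thus be verified without an induction over both
  signs.\<close>

lemma (in group) int_pow_unique:
  fixes f :: "int \<Rightarrow> 'a"
  assumes "\<And>i. f i \<in> carrier G" "\<And>i j. f (i + j) = f i \<otimes> f j"
  shows "f 1 [^] (n::int) = f n"
proof -
  have "f \<in> hom integer_group G" using assms by (auto simp: hom_def)
  from hom_int_pow[OF this _ group_integer_group, of 1 n] show ?thesis
    using is_group by simp
qed

text \<open>Conjugation by \<open>g\<close> is a homomorphism sending \<open>x\<close> to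
  \<open>y\<close>, so it sends powers to powers. It serves to move generators past powers in the
  presented group.\<close>

lemma (in group) int_pow_conj:
  assumes "g \<in> carrier G" "x \<in> carrier G" "y \<in> carrier G" "g \<otimes> x = y \<otimes> g"
  shows "g \<otimes> x [^] (n::int) = y [^] n \<otimes> g"
proof -
  have "(\<lambda>t. g \<otimes> t \<otimes> inv g) \<in> hom G G"
    using assms by (auto simp: hom_def m_assoc) (metis inv_closed l_inv l_one m_assoc m_closed)
  from hom_int_pow[OF this assms(2)] is_group
  have "g \<otimes> x [^] n \<otimes> inv g = (g \<otimes> x \<otimes> inv g) [^] n" by simp
  also have "g \<otimes> x \<otimes> inv g = y" using assms by (simp add: m_assoc)
  finally have "g \<otimes> x [^] n \<otimes> inv g \<otimes> g = y [^] n \<otimes> g" by simp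
  then show ?thesis using assms by (simp add: m_assoc)
qed

lemma flat_int_pow:
  "(v, 0) [^]\<^bsub>flat_model\<^esub> (n::int) = (of_int n * v, 0)"
  "(0, 1) [^]\<^bsub>flat_model\<^esub> (n::int) = (0, n)"
  using flat.int_pow_unique[of "\<lambda>i. (of_int i * v, 0)" n] flat.int_pow_unique[of "\<lambda>i. (0, i)" n]
  by (simp_all add: algebra_simps)

section \<open>Identifying the presented group with the model\<close>

definition G3_rels :: "(xyz word \<times> xyz word) set" where
  "G3_rels = (let x = gen Gen_x; y = gen Gen_y; z = gen Gen_z in
     {(x @ y @ inv_word x @ inv_word y, []),
      (z @ x @ inv_word z, y),
      (z @ y @ inv_word z, inv_word (x @ y))})"

lemma pi1_G3_eq: "pi1_G3 = presented_group G3_rels"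
  by (simp add: pi1_G3_def G3_rels_def Let_def)

fun gen_value :: "xyz \<Rightarrow> eis \<times> int" where
  "gen_value Gen_x = (1, 0)"
| "gen_value Gen_y = (zeta, 0)"
| "gen_value Gen_z = (0, 1)"

fun word_value :: "xyz word \<Rightarrow> eis \<times> int" where
  "word_value [] = (0, 0)"
| "word_value ((a, e) # w) =
    (if e then gen_value a else inv\<^bsub>flat_model\<^esub> gen_value a) \<otimes>\<^bsub>flat_model\<^esub> word_value w"

lemma word_value_append: "word_value (u @ v) = word_value u \<otimes>\<^bsub>flat_model\<^esub> word_value v"
proof (induction u rule: word_value.induct)
  case 1
  then show ?case using flat.l_one[of "word_value v"] by simp
next
  case (2 a e w)
  then show ?case by (simp add: flat.m_assoc)
qed

lemma word_value_cong: "pres_eq G3_rels u v \<Longrightarrow> word_value u = word_value v"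
proof (induction rule: pres_eq.induct)
  case (cancel a e)
  then show ?case
    using flat.l_inv[of "gen_value a"] flat.r_inv[of "gen_value a"]
    by (cases e) simp_all
next
  case (rel u v)
  then show ?case
    by (auto simp: G3_rels_def Let_def gen_def inv_word_def inv_flat_model eis_eq_iff zeta_pow_def zeta_def)
qed (simp_all add: word_value_append)

text \<open>The chosen representative does not affect the result, because \<open>word_value\<close>
  is constant on classes by \<open>word_value_cong\<close>.\<close>

definition class_value :: "xyz word set \<Rightarrow> eis \<times> int" where
  "class_value C = word_value (SOME w. word_class G3_rels w = C)"

lemma class_value: "class_value (word_class G3_rels w) = word_value w"
proof -
  have "word_class G3_rels (SOME v. word_class G3_rels v = word_class G3_rels w) = word_class G3_rels w"
    by (rule someI) simp
  then show ?thesis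
    unfolding class_value_def by (simp add: word_class_eq_iff word_value_cong)
qed

definition gen_class :: "xyz \<Rightarrow> xyz word set" where
  "gen_class a = word_class G3_rels [(a, True)]"

interpretation pi1: group pi1_G3
  unfolding pi1_G3_eq by (rule group_presented_group)

lemma carrier_pi1_G3: "carrier pi1_G3 = range (word_class G3_rels)"
  by (simp add: pi1_G3_eq presented_group_def)

lemma word_class_closed [simp, intro]: "word_class G3_rels w \<in> carrier pi1_G3"
  by (simp add: carrier_pi1_G3)

lemma gen_class_closed [simp, intro]: "gen_class a \<in> carrier pi1_G3"
  by (simp add: gen_class_def)

lemma word_class_append:
  "word_class G3_rels (u @ v) = word_class G3_rels u \<otimes>\<^bsub>pi1_G3\<^esub> word_class G3_rels v"
  by (simp add: pi1_G3_eq mult_word_class)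

lemma one_pi1_G3: "\<one>\<^bsub>pi1_G3\<^esub> = word_class G3_rels []"
  by (simp add: pi1_G3_eq presented_group_def)

lemma word_class_inv: "word_class G3_rels [(a, False)] = inv\<^bsub>pi1_G3\<^esub> gen_class a"
proof (rule pi1.inv_equality[symmetric])
  have "pres_eq G3_rels [(a, False), (a, \<not> False)] []" by (rule pres_eq.cancel)
  then show "word_class G3_rels [(a, False)] \<otimes>\<^bsub>pi1_G3\<^esub> gen_class a = \<one>\<^bsub>pi1_G3\<^esub>"
    by (simp add: gen_class_def one_pi1_G3 word_class_eq_iff flip: word_class_append)
qed auto

lemma word_class_Cons:
  "word_class G3_rels ((a, e) # w) =
    (if e then gen_class a else inv\<^bsub>pi1_G3\<^esub> gen_class a) \<otimes>\<^bsub>pi1_G3\<^esub> word_class G3_rels w"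
  using word_class_append[of "[(a, e)]" w] by (cases e) (simp add: gen_class_def, simp add: word_class_inv)

text \<open>The three relators, solved into commutation rules of the shape that
  \<open>int_pow_conj\<close> takes.\<close>

lemma gen_class_rels:
  shows XY: "gen_class Gen_x \<otimes>\<^bsub>pi1_G3\<^esub> gen_class Gen_y = gen_class Gen_y \<otimes>\<^bsub>pi1_G3\<^esub> gen_class Gen_x"
    and ZX: "gen_class Gen_z \<otimes>\<^bsub>pi1_G3\<^esub> gen_class Gen_x = gen_class Gen_y \<otimes>\<^bsub>pi1_G3\<^esub> gen_class Gen_z"
    and ZY: "gen_class Gen_z \<otimes>\<^bsub>pi1_G3\<^esub> gen_class Gen_y =
      inv\<^bsub>pi1_G3\<^esub> (gen_class Gen_x \<otimes>\<^bsub>pi1_G3\<^esub> gen_class Gen_y) \<otimes>\<^bsub>pi1_G3\<^esub> gen_class Gen_z"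
proof -
  let ?x = "gen_class Gen_x" and ?y = "gen_class Gen_y" and ?z = "gen_class Gen_z"
  note [simp] = word_class_Cons one_pi1_G3[symmetric]
  have "word_class G3_rels [(Gen_x, True), (Gen_y, True), (Gen_x, False), (Gen_y, False)] = word_class G3_rels []"
    "word_class G3_rels [(Gen_z, True), (Gen_x, True), (Gen_z, False)] = word_class G3_rels [(Gen_y, True)]"
    "word_class G3_rels [(Gen_z, True), (Gen_y, True), (Gen_z, False)] = word_class G3_rels [(Gen_y, False), (Gen_x, False)]"
    unfolding word_class_eq_iff
    by (rule pres_eq.rel, simp add: G3_rels_def Let_def gen_def inv_word_def)+
  then have 1: "?x \<otimes>\<^bsub>pi1_G3\<^esub> (?y \<otimes>\<^bsub>pi1_G3\<^esub> (inv\<^bsub>pi1_G3\<^esub> ?x \<otimes>\<^bsub>pi1_G3\<^esub> inv\<^bsub>pi1_G3\<^esub> ?y)) = \<one>\<^bsub>pi1_G3\<^esub>"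
    and 2: "?z \<otimes>\<^bsub>pi1_G3\<^esub> (?x \<otimes>\<^bsub>pi1_G3\<^esub> inv\<^bsub>pi1_G3\<^esub> ?z) = ?y"
    and 3: "?z \<otimes>\<^bsub>pi1_G3\<^esub> (?y \<otimes>\<^bsub>pi1_G3\<^esub> inv\<^bsub>pi1_G3\<^esub> ?z) = inv\<^bsub>pi1_G3\<^esub> ?y \<otimes>\<^bsub>pi1_G3\<^esub> inv\<^bsub>pi1_G3\<^esub> ?x"
    by simp_all
  have "?x \<otimes>\<^bsub>pi1_G3\<^esub> ?y \<otimes>\<^bsub>pi1_G3\<^esub> inv\<^bsub>pi1_G3\<^esub> (?y \<otimes>\<^bsub>pi1_G3\<^esub> ?x) = \<one>\<^bsub>pi1_G3\<^esub>"
    using 1 by (simp add: pi1.inv_mult_group pi1.m_assoc)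
  then show "?x \<otimes>\<^bsub>pi1_G3\<^esub> ?y = ?y \<otimes>\<^bsub>pi1_G3\<^esub> ?x"
    by (metis gen_class_closed pi1.inv_closed pi1.inv_equality pi1.inv_inv pi1.m_closed)
  have "?z \<otimes>\<^bsub>pi1_G3\<^esub> (?x \<otimes>\<^bsub>pi1_G3\<^esub> inv\<^bsub>pi1_G3\<^esub> ?z) \<otimes>\<^bsub>pi1_G3\<^esub> ?z = ?z \<otimes>\<^bsub>pi1_G3\<^esub> ?x"
    by (simp add: pi1.m_assoc)
  then show "?z \<otimes>\<^bsub>pi1_G3\<^esub> ?x = ?y \<otimes>\<^bsub>pi1_G3\<^esub> ?z" using 2 by simp
  have "?z \<otimes>\<^bsub>pi1_G3\<^esub> (?y \<otimes>\<^bsub>pi1_G3\<^esub> inv\<^bsub>pi1_G3\<^esub> ?z) \<otimes>\<^bsub>pi1_G3\<^esub> ?z = ?z \<otimes>\<^bsub>pi1_G3\<^esub> ?y"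
    by (simp add: pi1.m_assoc)
  then show "?z \<otimes>\<^bsub>pi1_G3\<^esub> ?y = inv\<^bsub>pi1_G3\<^esub> (?x \<otimes>\<^bsub>pi1_G3\<^esub> ?y) \<otimes>\<^bsub>pi1_G3\<^esub> ?z"
    using 3 by (simp add: pi1.inv_mult_group)
qed

text \<open>The candidate inverse of \<open>class_value\<close>: the class of x^i y^j z^c for the
  model element (i + j zeta, c).\<close>

definition normal_form :: "eis \<times> int \<Rightarrow> xyz word set" where
  "normal_form m = gen_class Gen_x [^]\<^bsub>pi1_G3\<^esub> er (fst m)
     \<otimes>\<^bsub>pi1_G3\<^esub> (gen_class Gen_y [^]\<^bsub>pi1_G3\<^esub> ei (fst m) \<otimes>\<^bsub>pi1_G3\<^esub> gen_class Gen_z [^]\<^bsub>pi1_G3\<^esub> snd m)"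

lemma normal_form_closed [simp, intro]: "normal_form m \<in> carrier pi1_G3"
  by (simp add: normal_form_def)

text \<open>The generator is moved rightwards to its own power. For z the rules z x^i = y^i z and z
  y^j = x^(-j) y^(-j) z mirror zeta (i + j zeta) = -j + (i - j) zeta.\<close>

lemma gen_class_mult_normal_form:
  "gen_class a \<otimes>\<^bsub>pi1_G3\<^esub> normal_form m = normal_form (gen_value a \<otimes>\<^bsub>flat_model\<^esub> m)"
proof -
  obtain u c where m: "m = (u, c)" by (cases m)
  define i where "i = er u"
  define j where "j = ei u"
  let ?x = "gen_class Gen_x" and ?y = "gen_class Gen_y" and ?z = "gen_class Gen_z"
  let ?px = "\<lambda>i::int. ?x [^]\<^bsub>pi1_G3\<^esub> i" and ?py = "\<lambda>i::int. ?y [^]\<^bsub>pi1_G3\<^esub> i"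
    and ?pz = "\<lambda>i::int. ?z [^]\<^bsub>pi1_G3\<^esub> i"
  have pow: "?px (i + 1) = ?x \<otimes>\<^bsub>pi1_G3\<^esub> ?px i" "?py (i + 1) = ?y \<otimes>\<^bsub>pi1_G3\<^esub> ?py i"
    "?pz (i + 1) = ?z \<otimes>\<^bsub>pi1_G3\<^esub> ?pz i" for i
    by (simp_all add: add.commute[of i] pi1.int_pow_mult)
  have yx: "?y \<otimes>\<^bsub>pi1_G3\<^esub> ?px i = ?px i \<otimes>\<^bsub>pi1_G3\<^esub> ?y" for i
    by (rule pi1.int_pow_conj) (simp_all add: XY)
  have yx': "?py j \<otimes>\<^bsub>pi1_G3\<^esub> ?px i = ?px i \<otimes>\<^bsub>pi1_G3\<^esub> ?py j" for i j
    by (rule pi1.int_pow_conj[symmetric]) (simp_all add: yx)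
  have zx: "?z \<otimes>\<^bsub>pi1_G3\<^esub> ?px i = ?py i \<otimes>\<^bsub>pi1_G3\<^esub> ?z" for i
    by (rule pi1.int_pow_conj) (simp_all add: ZX)
  have zy: "?z \<otimes>\<^bsub>pi1_G3\<^esub> ?py j = ?px (- j) \<otimes>\<^bsub>pi1_G3\<^esub> ?py (- j) \<otimes>\<^bsub>pi1_G3\<^esub> ?z" for j
  proof -
    have "?z \<otimes>\<^bsub>pi1_G3\<^esub> ?py j = inv\<^bsub>pi1_G3\<^esub> (?x \<otimes>\<^bsub>pi1_G3\<^esub> ?y) [^]\<^bsub>pi1_G3\<^esub> j \<otimes>\<^bsub>pi1_G3\<^esub> ?z"
      by (rule pi1.int_pow_conj) (simp_all add: ZY)
    also have "inv\<^bsub>pi1_G3\<^esub> (?x \<otimes>\<^bsub>pi1_G3\<^esub> ?y) [^]\<^bsub>pi1_G3\<^esub> j = (?x \<otimes>\<^bsub>pi1_G3\<^esub> ?y) [^]\<^bsub>pi1_G3\<^esub> (- j)"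
      by (simp add: pi1.int_pow_inv pi1.int_pow_neg)
    also have "\<dots> = ?px (- j) \<otimes>\<^bsub>pi1_G3\<^esub> ?py (- j)"
      by (rule pi1.int_pow_mult_distrib) (simp_all add: XY)
    finally show ?thesis .
  qed
  show ?thesis
  proof (cases a)
    case Gen_x
    then show ?thesis
      by (simp add: m normal_form_def add.commute[of 1] pow pi1.m_assoc)
  next
    case Gen_y
    have "?y \<otimes>\<^bsub>pi1_G3\<^esub> (?px i \<otimes>\<^bsub>pi1_G3\<^esub> (?py j \<otimes>\<^bsub>pi1_G3\<^esub> ?pz c)) =
        ?px i \<otimes>\<^bsub>pi1_G3\<^esub> (?py (j + 1) \<otimes>\<^bsub>pi1_G3\<^esub> ?pz c)"
      using yx[of i] by (simp add: pow pi1.m_assoc flip: pi1.m_assoc[of ?y "?px i"])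
    then show ?thesis
      using Gen_y by (simp add: m normal_form_def add.commute[of 1] i_def j_def zeta_def)
  next
    case Gen_z
    have "?z \<otimes>\<^bsub>pi1_G3\<^esub> (?px i \<otimes>\<^bsub>pi1_G3\<^esub> (?py j \<otimes>\<^bsub>pi1_G3\<^esub> ?pz c)) =
        ?py i \<otimes>\<^bsub>pi1_G3\<^esub> (?z \<otimes>\<^bsub>pi1_G3\<^esub> ?py j) \<otimes>\<^bsub>pi1_G3\<^esub> ?pz c"
      using zx[of i] by (simp add: pi1.m_assoc flip: pi1.m_assoc[of ?z "?px i"])
    also have "\<dots> = ?py i \<otimes>\<^bsub>pi1_G3\<^esub> ?px (- j) \<otimes>\<^bsub>pi1_G3\<^esub> ?py (- j) \<otimes>\<^bsub>pi1_G3\<^esub> ?z \<otimes>\<^bsub>pi1_G3\<^esub> ?pz c"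
      unfolding zy by (simp add: pi1.m_assoc)
    also have "\<dots> = ?px (- j) \<otimes>\<^bsub>pi1_G3\<^esub> (?py i \<otimes>\<^bsub>pi1_G3\<^esub> ?py (- j)) \<otimes>\<^bsub>pi1_G3\<^esub> ?pz (c + 1)"
      unfolding yx' pow by (simp add: pi1.m_assoc)
    also have "?py i \<otimes>\<^bsub>pi1_G3\<^esub> ?py (- j) = ?py (i - j)"
      by (simp flip: pi1.int_pow_mult)
    finally show ?thesis
      using Gen_z by (simp add: m normal_form_def add.commute[of 1] i_def j_def zeta_def pi1.m_assoc)
  qed
qed

text \<open>The relations suffice to bring each word to the form dictated by its value; this yields
  the injectivity of \<open>class_value\<close>.\<close>

lemma word_class_eq_normal_form: "word_class G3_rels w = normal_form (word_value w)"
proof (induction w rule: word_value.induct)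
  case 1
  then show ?case by (simp add: normal_form_def one_pi1_G3[symmetric])
next
  case (2 a e w)
  show ?case
  proof (cases e)
    case True
    then show ?thesis using 2 by (simp add: word_class_Cons gen_class_mult_normal_form)
  next
    case False
    let ?m = "inv\<^bsub>flat_model\<^esub> gen_value a \<otimes>\<^bsub>flat_model\<^esub> word_value w"
    \<comment> \<open>An inverse letter is handled by the rule for the generator itself, applied to
      \<open>?m\<close> and then solved for \<open>normal_form ?m\<close>.\<close>
    have "gen_class a \<otimes>\<^bsub>pi1_G3\<^esub> normal_form ?m = normal_form (word_value w)"
      unfolding gen_class_mult_normal_form by (simp flip: flat.m_assoc)
    then have "normal_form ?m = inv\<^bsub>pi1_G3\<^esub> gen_class a \<otimes>\<^bsub>pi1_G3\<^esub> normal_form (word_value w)"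
      using pi1.inv_solve_left by auto
    then show ?thesis using False 2 by (simp add: word_class_Cons)
  qed
qed

lemma class_value_iso: "class_value \<in> iso pi1_G3 flat_model"
proof (rule isoI)
  show hom: "class_value \<in> hom pi1_G3 flat_model"
    by (rule homI) (auto simp: carrier_pi1_G3 class_value word_value_append simp flip: word_class_append)
  show "bij_betw class_value (carrier pi1_G3) (carrier flat_model)"
  proof (rule bij_betw_imageI)
    show "inj_on class_value (carrier pi1_G3)"
      by (rule inj_on_inverseI[of _ normal_form])
        (auto simp: carrier_pi1_G3 class_value word_class_eq_normal_form[symmetric])
    have "class_value (normal_form m) = m" for m
    proof -
      have gv: "class_value (gen_class a) = gen_value a" for a
        using flat.r_one[of "gen_value a"] by (simp add: gen_class_def class_value)
      have pow: "class_value (x [^]\<^bsub>pi1_G3\<^esub> n) = class_value x [^]\<^bsub>flat_model\<^esub> n"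
        if "x \<in> carrier pi1_G3" for x and n :: int
        by (rule hom_int_pow[OF hom that pi1.is_group group_flat_model])
      show ?thesis
        by (cases m) (simp add: normal_form_def hom_mult[OF hom] pow gv flat_int_pow eis_eq_iff zeta_def)
    qed
    then have "m \<in> class_value ` carrier pi1_G3" for m
      using imageI[OF normal_form_closed[of m], of class_value] by simp
    then show "class_value ` carrier pi1_G3 = carrier flat_model" by auto
  qed
qed

section \<open>Subgroups of finite index\<close>

lemma iso_restrict_image:
  assumes "group G" "group H" "\<phi> \<in> iso G H" "subgroup K G"
  shows "subgroup (\<phi> ` K) H" "G\<lparr>carrier := K\<rparr> \<cong> H\<lparr>carrier := \<phi> ` K\<rparr>"
proof -
  interpret group_hom G H \<phi>
    using assms by (simp add: group_hom_def group_hom_axioms_def iso_def)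
  show "subgroup (\<phi> ` K) H" using assms(4) by (rule subgroup_img_is_subgroup)
  have sub: "K \<subseteq> carrier G" using assms(4) by (rule subgroup.subset)
  have inj: "inj_on \<phi> K"
    using assms(3) sub by (auto simp: iso_def bij_betw_def intro: inj_on_subset)
  then have "\<phi> \<in> iso (G\<lparr>carrier := K\<rparr>) (H\<lparr>carrier := \<phi> ` K\<rparr>)"
    using sub by (auto simp: iso_def hom_def bij_betw_def subset_iff)
  then show "G\<lparr>carrier := K\<rparr> \<cong> H\<lparr>carrier := \<phi> ` K\<rparr>" by (rule is_isoI)
qed

lemma has_index_iso_image:
  assumes "group G" "group H" "\<phi> \<in> iso G H" "subgroup K G" "has_index G K n"
  shows "has_index H (\<phi> ` K) n"
proof -
  interpret group_hom G H \<phi>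
    using assms by (simp add: group_hom_def group_hom_axioms_def iso_def)
  have sub: "K \<subseteq> carrier G" using assms(4) by (rule subgroup.subset)
  have inj: "inj_on \<phi> (carrier G)" and surj: "\<phi> ` carrier G = carrier H"
    using assms(3) by (auto simp: iso_def bij_betw_def)
  have coset: "\<phi> ` K #>\<^bsub>H\<^esub> \<phi> x = \<phi> ` (K #>\<^bsub>G\<^esub> x)" if "x \<in> carrier G" for x
    using sub that by (force simp: r_coset_def image_iff subset_iff)
  have "rcosets\<^bsub>H\<^esub> (\<phi> ` K) = (\<lambda>x. \<phi> ` K #>\<^bsub>H\<^esub> \<phi> x) ` carrier G"
    unfolding RCOSETS_def surj[symmetric] by auto
  also have "\<dots> = image \<phi> ` (rcosets\<^bsub>G\<^esub> K)"
    unfolding RCOSETS_def by (auto simp: coset image_iff)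
  finally have eq: "rcosets\<^bsub>H\<^esub> (\<phi> ` K) = image \<phi> ` (rcosets\<^bsub>G\<^esub> K)" .
  have "rcosets\<^bsub>G\<^esub> K \<subseteq> Pow (carrier G)"
    using assms(1,4) by (simp add: group.rcosets_subset_PowG)
  then have "inj_on (image \<phi>) (rcosets\<^bsub>G\<^esub> K)"
    using inj_on_image_Pow[OF inj] inj_on_subset by blast
  then show ?thesis using assms(5) by (simp add: has_index_def eq card_image)
qed

lemma iso_subgroups_image:
  assumes "group G" "group H" "\<phi> \<in> iso G H" "K \<in> iso_subgroups T G n"
  shows "\<phi> ` K \<in> iso_subgroups T H n"
proof -
  have K: "subgroup K G" "has_index G K n" "G\<lparr>carrier := K\<rparr> \<cong> T"
    using assms(4) by (auto simp: iso_subgroups_def)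
  have "H\<lparr>carrier := \<phi> ` K\<rparr> \<cong> G\<lparr>carrier := K\<rparr>"
    using iso_restrict_image[OF assms(1-3) K(1)] subgroup.subgroup_is_group[OF K(1) assms(1)]
    by (simp add: group.iso_sym)
  with K show ?thesis
    using iso_restrict_image[OF assms(1-3) K(1)] has_index_iso_image[OF assms(1-3) K(1,2)]
      iso_trans by (auto simp: iso_subgroups_def)
qed

lemma bij_betw_iso_subgroups:
  assumes "group G" "group H" "\<phi> \<in> iso G H"
  shows "bij_betw (image \<phi>) (iso_subgroups T G n) (iso_subgroups T H n)"
proof -
  define \<psi> where "\<psi> = inv_into (carrier G) \<phi>"
  have \<psi>: "\<psi> \<in> iso H G" unfolding \<psi>_def by (rule group.iso_set_sym[OF assms(1,3)])
  have bij: "bij_betw \<phi> (carrier G) (carrier H)" using assms(3) by (simp add: iso_def)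
  have sub: "K \<subseteq> carrier G" if "K \<in> iso_subgroups T G n" for K
    using that by (auto simp: iso_subgroups_def dest: subgroup.subset)
  have sub': "K \<subseteq> carrier H" if "K \<in> iso_subgroups T H n" for K
    using that by (auto simp: iso_subgroups_def dest: subgroup.subset)
  show ?thesis
  proof (rule bij_betw_byWitness[where f' = "image \<psi>"])
    show "\<forall>K\<in>iso_subgroups T G n. \<psi> ` \<phi> ` K = K"
      using sub bij by (simp add: \<psi>_def bij_betw_def inv_into_image_cancel)
    show "\<forall>K\<in>iso_subgroups T H n. \<phi> ` \<psi> ` K = K"
      using sub' bij by (simp add: \<psi>_def bij_betw_def image_inv_into_cancel)
  qed (use iso_subgroups_image assms \<psi> in blast)+
qed

lemma (in group) rcos_eq_iff:
  assumes "subgroup K G" "x \<in> carrier G" "y \<in> carrier G"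
  shows "K #> x = K #> y \<longleftrightarrow> x \<otimes> inv y \<in> K"
proof -
  have "K #> x = K #> y \<longleftrightarrow> x \<in> K #> y"
    using assms rcos_self repr_independence by metis
  also have "\<dots> \<longleftrightarrow> x \<otimes> inv y \<in> K"
    using subgroup.rcos_module[OF assms(1) is_group] assms(2,3) by blast
  finally show ?thesis .
qed

text \<open>Pigeonhole: two powers of \<open>g\<close> lie in the same coset, and their quotient is
  a positive power in \<open>K\<close>.\<close>

lemma (in group) finite_index_pow_mem:
  assumes "subgroup K G" "finite (rcosets K)" "g \<in> carrier G"
  shows "\<exists>n::int. n > 0 \<and> g [^] n \<in> K"
proof -
  let ?f = "\<lambda>n::nat. K #> g [^] int n"
  have "range ?f \<subseteq> rcosets K"
    using assms(3) subgroup.subset[OF assms(1)] by (auto intro!: rcosetsI)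
  then have "\<not> inj ?f"
    using assms(2) finite_imageD[of ?f UNIV] finite_subset infinite_UNIV_nat by blast
  then obtain i j where ij: "?f i = ?f j" "i < j"
    unfolding inj_def by (metis linorder_neqE_nat)
  then have "g [^] int j \<otimes> inv (g [^] int i) \<in> K"
    using rcos_eq_iff[OF assms(1), of "g [^] int j" "g [^] int i"] assms(3) by simp
  then have "g [^] (int j - int i) \<in> K"
    using assms(3) by (simp add: int_pow_diff)
  then show ?thesis using ij(2) by (intro exI[of _ "int j - int i"]) simp
qed

lemma int_subgroup_generated:
  fixes S :: "int set"
  assumes diff: "\<And>x y. x \<in> S \<Longrightarrow> y \<in> S \<Longrightarrow> x - y \<in> S" and "g0 \<in> S" "g0 > 0"
  shows "\<exists>g>0. S = {x. g dvd x}"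
proof -
  define m where "m = (LEAST m::nat. m > 0 \<and> int m \<in> S)"
  have ex: "nat g0 > 0 \<and> int (nat g0) \<in> S" using assms by simp
  have m: "m > 0" "int m \<in> S"
    using LeastI[of "\<lambda>m. m > 0 \<and> int m \<in> S", OF ex] by (simp_all add: m_def)
  have least: "m \<le> k" if "k > 0" "int k \<in> S" for k
    unfolding m_def by (rule Least_le) (use that in simp)
  have zero: "0 \<in> S" using diff[OF m(2) m(2)] by simp
  have neg: "- x \<in> S" if "x \<in> S" for x using diff[OF zero that] by simp
  have add: "x + y \<in> S" if "x \<in> S" "y \<in> S" for x y using diff[OF that(1) neg[OF that(2)]] by simp
  have mult: "int m * q \<in> S" for q
    by (induction q rule: int_induct[where k = 0]) (simp_all add: zero add diff m(2) algebra_simps)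
  have "x \<in> S \<longleftrightarrow> int m dvd x" for x
  proof
    assume "x \<in> S"
    then have "x mod int m \<in> S" using diff[OF _ mult, of x "x div int m"]
      by (simp add: minus_mult_div_eq_mod)
    moreover have "x mod int m < int m" using m(1) by simp
    ultimately have "\<not> 0 < x mod int m"
      using least[of "nat (x mod int m)"] by force
    then show "int m dvd x"
      using m(1) pos_mod_sign[of "int m" x] by (simp add: dvd_eq_mod_eq_0 del: pos_mod_sign)
  qed (auto simp: mult)
  then show ?thesis using m(1) by (intro exI[of _ "int m"]) auto
qed

lemma dvd_set_eqD:
  fixes g h :: int
  assumes "g > 0" "h > 0" "{x. g dvd x} = {x. h dvd x}"
  shows "g = h"
proof (rule zdvd_antisym_nonneg)
  show "g dvd h" "h dvd g" using assms(3) by (metis dvd_refl mem_Collect_eq)+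
qed (use assms in simp_all)

section \<open>Lattices in Hermite normal form\<close>

definition add_closed :: "eis set \<Rightarrow> bool" where
  "add_closed L \<longleftrightarrow> 0 \<in> L \<and> (\<forall>u\<in>L. \<forall>v\<in>L. u - v \<in> L)"

lemma add_closedD:
  assumes "add_closed L"
  shows "0 \<in> L" "u \<in> L \<Longrightarrow> v \<in> L \<Longrightarrow> u - v \<in> L" "u \<in> L \<Longrightarrow> - u \<in> L" "u \<in> L \<Longrightarrow> v \<in> L \<Longrightarrow> u + v \<in> L"
proof -
  show 0: "0 \<in> L" and "u \<in> L \<Longrightarrow> v \<in> L \<Longrightarrow> u - v \<in> L"
    using assms by (simp_all add: add_closed_def)
  have diff: "x - y \<in> L" if "x \<in> L" "y \<in> L" for x y
    using assms that by (simp add: add_closed_def)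
  have neg: "- x \<in> L" if "x \<in> L" for x using diff[OF 0 that] by simp
  show "u \<in> L \<Longrightarrow> - u \<in> L" by (rule neg)
  assume "u \<in> L" "v \<in> L"
  then have "u - - v \<in> L" by (intro diff neg)
  then show "u + v \<in> L" by simp
qed

lemma add_closed_of_int_mult:
  assumes "add_closed L" "u \<in> L"
  shows "of_int n * u \<in> L"
  by (induction n rule: int_induct[where k = 0])
    (simp_all add: assms add_closedD[OF assms(1)] algebra_simps)

text \<open>In Hermite normal form a lattice is spanned by \<open>a\<close> and \<open>b + d \<zeta>\<close> with \<open>0 \<le> b < a\<close> and
  \<open>d > 0\<close>.\<close>

definition hnf :: "int \<Rightarrow> int \<Rightarrow> int \<Rightarrow> eis set" where
  "hnf a b d = {u. d dvd ei u \<and> a dvd er u - b * (ei u div d)}"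

text \<open>A set of representatives of Z[zeta] modulo \<open>hnf a b d\<close>, the same for every
  \<open>b\<close>; so this lattice has index \<open>a * d\<close>.\<close>

definition box :: "int \<Rightarrow> int \<Rightarrow> eis set" where
  "box a d = {u. 0 \<le> er u \<and> er u < a \<and> 0 \<le> ei u \<and> ei u < d}"

lemma hnf_iff:
  assumes "d > 0"
  shows "u \<in> hnf a b d \<longleftrightarrow> (\<exists>p q. u = Eis (p * a + q * b) (q * d))"
proof
  assume "u \<in> hnf a b d"
  then have "d dvd ei u" "a dvd er u - b * (ei u div d)" by (simp_all add: hnf_def)
  then obtain q p where "ei u = d * q" "er u - b * (ei u div d) = a * p" by (metis dvdE)
  then show "\<exists>p q. u = Eis (p * a + q * b) (q * d)"
    using assms by (intro exI[of _ p] exI[of _ q]) (simp add: eis_eq_iff algebra_simps)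
qed (use assms in \<open>auto simp: hnf_def\<close>)

lemma add_closed_hnf:
  assumes "d > 0"
  shows "add_closed (hnf a b d)"
  unfolding add_closed_def
proof (intro conjI ballI)
  show "0 \<in> hnf a b d" by (simp add: hnf_def)
  fix u v assume "u \<in> hnf a b d" "v \<in> hnf a b d"
  then obtain p q r s where "u = Eis (p * a + q * b) (q * d)" "v = Eis (r * a + s * b) (s * d)"
    by (auto simp: hnf_iff[OF assms])
  then have "u - v = Eis ((p - r) * a + (q - s) * b) ((q - s) * d)"
    by (simp add: eis_eq_iff algebra_simps)
  then show "u - v \<in> hnf a b d" by (auto simp: hnf_iff[OF assms])
qed

text \<open>\<open>a\<close> generates the rational integers in \<open>L\<close>, \<open>d\<close>
  generates the zeta-coordinates of \<open>L\<close>, and \<open>b\<close> is the first coordinate,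
  reduced modulo \<open>a\<close>, of any element with zeta-coordinate \<open>d\<close>. The two
  given elements make both subgroups of Z nonzero.\<close>

lemma hnf_exists:
  assumes L: "add_closed L" and "Eis a0 0 \<in> L" "a0 > 0" "Eis 0 d0 \<in> L" "d0 > 0"
  shows "\<exists>a b d. a > 0 \<and> 0 \<le> b \<and> b < a \<and> d > 0 \<and> L = hnf a b d"
proof -
  have "\<exists>a>0. {s. Eis s 0 \<in> L} = {s. a dvd s}"
  proof (rule int_subgroup_generated)
    show "x - y \<in> {s. Eis s 0 \<in> L}" if "x \<in> {s. Eis s 0 \<in> L}" "y \<in> {s. Eis s 0 \<in> L}" for x y
      using add_closedD(2)[OF L, of "Eis x 0" "Eis y 0"] that by (simp add: minus_eis_def)
  qed (use assms in auto)
  then obtain a where a: "a > 0" "\<And>s. Eis s 0 \<in> L \<longleftrightarrow> a dvd s" by blast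
  have "\<exists>d>0. ei ` L = {t. d dvd t}"
  proof (rule int_subgroup_generated)
    show "x - y \<in> ei ` L" if "x \<in> ei ` L" "y \<in> ei ` L" for x y
      using that add_closedD(2)[OF L] by (auto simp: image_iff simp flip: ei_simps(4))
    show "d0 \<in> ei ` L" using assms(4) by (metis eis.sel(2) imageI)
  qed (rule assms)
  then obtain d where d: "d > 0" "ei ` L = {t. d dvd t}" by blast
  then obtain u0 where u0: "u0 \<in> L" "ei u0 = d" by (metis dvd_refl imageE mem_Collect_eq)
  define b where "b = er u0 mod a"
  have bd: "Eis b d \<in> L"
  proof -
    have "Eis (a * (er u0 div a)) 0 \<in> L" by (simp add: a(2))
    from add_closedD(2)[OF L u0(1) this] show ?thesis
      using u0(2) by (simp add: minus_eis_def b_def minus_mult_div_eq_mod)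
  qed
  have "u \<in> L \<longleftrightarrow> u \<in> hnf a b d" for u
  proof -
    have "u \<in> L \<longleftrightarrow> d dvd ei u \<and> u \<in> L" using d(2) by blast
    also have "\<dots> \<longleftrightarrow> d dvd ei u \<and> u - of_int (ei u div d) * Eis b d \<in> L"
      using add_closedD(2,4)[OF L] add_closed_of_int_mult[OF L bd] by (metis diff_add_cancel)
    also have "\<dots> \<longleftrightarrow> d dvd ei u \<and> Eis (er u - b * (ei u div d)) 0 \<in> L"
    proof -
      have "u - of_int (ei u div d) * Eis b d = Eis (er u - b * (ei u div d)) 0" if "d dvd ei u"
        using that by (simp add: eis_eq_iff)
      then show ?thesis by auto
    qed
    finally show ?thesis by (simp add: a(2) hnf_def)
  qed
  then have "L = hnf a b d" by blast
  moreover have "0 \<le> b" "b < a" using a(1) by (simp_all add: b_def)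
  ultimately show ?thesis using a(1) d(1) by blast
qed

text \<open>The lattice determines \<open>a\<close> and \<open>d\<close> as generators of subgroups
  of Z, and then \<open>b\<close> modulo \<open>a\<close>; the range of \<open>b\<close> does the
  rest.\<close>

lemma hnf_inject:
  assumes "a > 0" "0 \<le> b" "b < a" "d > 0" "a' > 0" "0 \<le> b'" "b' < a'" "d' > 0"
    and eq: "hnf a b d = hnf a' b' d'"
  shows "a = a' \<and> b = b' \<and> d = d'"
proof -
  have "{s. Eis s 0 \<in> hnf a b d} = {s. a dvd s}" for a b d by (simp add: hnf_def)
  then have a: "a = a'" using dvd_set_eqD assms(1,5) eq by metis
  have "ei ` hnf a b d = {t. d dvd t}" if "d > 0" for a b d
  proof (intro equalityI subsetI)
    fix t assume "t \<in> {t. d dvd t}"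
    then obtain q where "t = q * d" by (metis dvdE mem_Collect_eq mult.commute)
    moreover have "Eis (0 * a + q * b) (q * d) \<in> hnf a b d" using hnf_iff[OF that] by blast
    ultimately show "t \<in> ei ` hnf a b d" by (metis eis.sel(2) imageI)
  qed (auto simp: hnf_def)
  then have d: "d = d'" using dvd_set_eqD assms(4,8) eq by metis
  have "Eis b d \<in> hnf a' b' d'" unfolding eq[symmetric] using assms(4) by (simp add: hnf_def)
  then have "a dvd b - b'" using a d assms(4) by (simp add: hnf_def)
  then have "b = b'" using assms a by (metis cong_iff_dvd_diff cong_less_imp_eq_int)
  with a d show ?thesis by blast
qed

lemma box_exists:
  assumes "a > 0" "d > 0"
  shows "\<exists>t\<in>box a d. u - t \<in> hnf a b d"
proof -
  define q where "q = ei u div d"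
  let ?t = "Eis ((er u - b * q) mod a) (ei u mod d)"
  have "u - ?t = Eis ((er u - b * q) div a * a + q * b) (q * d)"
    by (simp add: eis_eq_iff q_def minus_mod_eq_div_mult algebra_simps)
  then have "u - ?t \<in> hnf a b d" using assms(2) by (auto simp: hnf_iff)
  moreover have "?t \<in> box a d" using assms by (simp add: box_def)
  ultimately show ?thesis by blast
qed

lemma box_unique:
  assumes "s \<in> box a d" "t \<in> box a d" "s - t \<in> hnf a b d"
  shows "s = t"
proof -
  have "d dvd ei s - ei t" using assms(3) by (simp add: hnf_def)
  then have "ei s = ei t" using assms(1,2)
    by (metis (mono_tags, lifting) box_def cong_iff_dvd_diff cong_less_imp_eq_int mem_Collect_eq)
  moreover from this have "a dvd er s - er t" using assms(3) by (simp add: hnf_def)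
  then have "er s = er t" using assms(1,2)
    by (metis (mono_tags, lifting) box_def cong_iff_dvd_diff cong_less_imp_eq_int mem_Collect_eq)
  ultimately show ?thesis by (simp add: eis_eq_iff)
qed

lemma card_box:
  assumes "a \<ge> 0" "d \<ge> 0"
  shows "finite (box a d)" "card (box a d) = nat (a * d)"
proof -
  have "bij_betw (\<lambda>(s, t). Eis s t) ({0..<a} \<times> {0..<d}) (box a d)"
    by (rule bij_betw_byWitness[where f' = "\<lambda>u. (er u, ei u)"]) (auto simp: box_def)
  then show "finite (box a d)" "card (box a d) = nat (a * d)"
    using assms bij_betw_finite by (force, simp add: bij_betw_same_card[symmetric] card_cartesian_product nat_mult_distrib)
qed

section \<open>Subgroups lifted from lattices\<close>

text \<open>For j > 0 this is the sum of zeta^(k i) v over 0 <= i < j. Taking it from the group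
  power covers negative j and turns the cocycle identity \<open>twist_add\<close> into a power
  law.\<close>

definition twist :: "int \<Rightarrow> eis \<Rightarrow> int \<Rightarrow> eis" where
  "twist k v j = fst ((v, k) [^]\<^bsub>flat_model\<^esub> j)"

lemma flat_int_pow_eq: "(v, k) [^]\<^bsub>flat_model\<^esub> (j::int) = (twist k v j, k * j)"
proof -
  have "snd \<in> hom flat_model integer_group"
    by (rule homI) auto
  from hom_int_pow[OF this _ group_flat_model group_integer_group, of "(v, k)" j]
  have "snd ((v, k) [^]\<^bsub>flat_model\<^esub> j) = k * j" by simp
  then show ?thesis by (simp add: twist_def prod_eq_iff)
qed

lemma twist_add: "twist k v (i + j) = twist k v i + zeta_pow (k * i) * twist k v j"
  using flat.int_pow_mult[of "(v, k)" i j] by (simp add: flat_int_pow_eq)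

lemma twist_0 [simp]: "twist k v 0 = 0"
  by (simp add: twist_def)

lemma twist_1 [simp]: "twist k v 1 = v"
  by (simp add: twist_def)

text \<open>The union of the cosets \<open>(L \<times> 0) (v, k)\<^sup>j\<close> over all integers \<open>j\<close>.\<close>

definition lift_lattice :: "eis set \<Rightarrow> int \<Rightarrow> eis \<Rightarrow> (eis \<times> int) set" where
  "lift_lattice L k v = {(u, c). k dvd c \<and> u - twist k v (c div k) \<in> L}"

lemma mem_lift_lattice:
  assumes "k > 0"
  shows "(u, k * j) \<in> lift_lattice L k v \<longleftrightarrow> u - twist k v j \<in> L"
  using assms by (simp add: lift_lattice_def)

text \<open>Conjugating (u, 0) by (x, c) gives (zeta^c u, 0), so this says that elements over
  multiples of \<open>k\<close> normalise the translations in \<open>L\<close>.\<close>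

definition zeta_pow_stable :: "int \<Rightarrow> eis set \<Rightarrow> bool" where
  "zeta_pow_stable k L \<longleftrightarrow> (\<forall>c u. k dvd c \<longrightarrow> u \<in> L \<longrightarrow> zeta_pow c * u \<in> L)"

lemma subgroup_lift_lattice:
  assumes L: "add_closed L" and st: "zeta_pow_stable k L" and k: "k > 0"
  shows "subgroup (lift_lattice L k v) flat_model"
proof (rule flat.subgroupI)
  let ?K = "lift_lattice L k v"
  have st': "zeta_pow (k * i) * u \<in> L" if "u \<in> L" for i u
    using st that by (simp add: zeta_pow_stable_def)
  show "?K \<noteq> {}" using mem_lift_lattice[OF k, of 0 0] add_closedD(1)[OF L] by auto
  fix x y assume x: "x \<in> ?K" and y: "y \<in> ?K"
  obtain u i where xu: "x = (u, k * i)" "u - twist k v i \<in> L"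
    using x k by (cases x) (auto simp: lift_lattice_def elim!: dvdE)
  obtain u' j where yu: "y = (u', k * j)" "u' - twist k v j \<in> L"
    using y k by (cases y) (auto simp: lift_lattice_def elim!: dvdE)
  have "(u - twist k v i) + zeta_pow (k * i) * (u' - twist k v j) \<in> L"
    by (intro add_closedD(4)[OF L] st' xu yu)
  also have "(u - twist k v i) + zeta_pow (k * i) * (u' - twist k v j) =
      (u + zeta_pow (k * i) * u') - twist k v (i + j)"
    by (simp add: twist_add algebra_simps)
  finally show "x \<otimes>\<^bsub>flat_model\<^esub> y \<in> ?K"
    using mem_lift_lattice[OF k, of _ "i + j"] xu yu by (simp add: distrib_left)
  have "twist k v (- i) = - (zeta_pow (- (k * i)) * twist k v i)"
    using twist_add[of k v "- i" i] by (simp add: eq_neg_iff_add_eq_0)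
  moreover have "- (zeta_pow (k * - i) * (u - twist k v i)) \<in> L"
    by (intro add_closedD(3)[OF L] st' xu)
  ultimately show "inv\<^bsub>flat_model\<^esub> x \<in> ?K"
    using mem_lift_lattice[OF k, of _ "- i"] xu by (simp add: inv_flat_model algebra_simps)
qed simp

text \<open>Pairs of a point of \<open>box a d\<close> and a residue in [0, k) represent the right
  cosets, once each.\<close>

lemma has_index_lift_lattice:
  assumes "a > 0" "d > 0" "k > 0" and st: "zeta_pow_stable k (hnf a b d)"
  shows "has_index flat_model (lift_lattice (hnf a b d) k v) (nat (k * (a * d)))"
proof -
  let ?K = "lift_lattice (hnf a b d) k v" and ?T = "box a d \<times> {0..<k}"
  let ?coset = "\<lambda>x. ?K #>\<^bsub>flat_model\<^esub> x"
  have sub: "subgroup ?K flat_model"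
    by (rule subgroup_lift_lattice[OF add_closed_hnf st]) (use assms in auto)
  have quot: "(u, c) \<otimes>\<^bsub>flat_model\<^esub> inv\<^bsub>flat_model\<^esub> (t, c') = (u - zeta_pow (c - c') * t, c - c')" for u t c c'
    using zeta_pow_add[of c "- c'"] by (simp add: inv_flat_model mult.assoc)
  have eq: "?coset (u, c) = ?coset (t, c') \<longleftrightarrow> (u - zeta_pow (c - c') * t, c - c') \<in> ?K" for u t c c'
    unfolding quot[symmetric] by (rule flat.rcos_eq_iff[OF sub]) auto
  have "inj_on ?coset ?T"
  proof (rule inj_onI, clarify)
    fix t c t' c'
    assume h: "t \<in> box a d" "c \<in> {0..<k}" "t' \<in> box a d" "c' \<in> {0..<k}" "?coset (t, c) = ?coset (t', c')"
    then have K: "(t - zeta_pow (c - c') * t', c - c') \<in> ?K" by (simp add: eq)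
    then have "k dvd c - c'" by (simp add: lift_lattice_def)
    then have "c = c'" using h by (metis atLeastLessThan_iff cong_iff_dvd_diff cong_less_imp_eq_int)
    moreover from this have "t - t' \<in> hnf a b d" using K by (simp add: lift_lattice_def)
    then have "t = t'" using box_unique h by blast
    ultimately show "t = t' \<and> c = c'" by blast
  qed
  moreover have "rcosets\<^bsub>flat_model\<^esub> ?K = ?coset ` ?T"
  proof (intro equalityI subsetI)
    fix C assume "C \<in> rcosets\<^bsub>flat_model\<^esub> ?K"
    then obtain u c where C: "C = ?coset (u, c)" by (auto simp: RCOSETS_def)
    define j where "j = c div k"
    have c: "c - c mod k = k * j" by (simp add: j_def minus_mod_eq_mult_div)
    \<comment> \<open>Left multiplication by an element over \<open>k * j\<close> twists the
      translation part of a representative by zeta^(k j). The twist is undone before reducing into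
      the box and restored afterwards by stability.\<close>
    obtain t where t: "t \<in> box a d" "zeta_pow (- (k * j)) * (u - twist k v j) - t \<in> hnf a b d"
      using box_exists assms(1,2) by blast
    have "zeta_pow (k * j) * (zeta_pow (- (k * j)) * (u - twist k v j) - t) \<in> hnf a b d"
      using st t(2) by (simp add: zeta_pow_stable_def)
    also have "zeta_pow (k * j) * (zeta_pow (- (k * j)) * (u - twist k v j) - t) =
        u - zeta_pow (k * j) * t - twist k v j"
      by (simp add: right_diff_distrib[of "zeta_pow (k * j)"] zeta_pow_inverse)
    finally have "(u - zeta_pow (c - c mod k) * t, c - c mod k) \<in> ?K"
      unfolding c mem_lift_lattice[OF assms(3)] .
    then have "C = ?coset (t, c mod k)" by (simp add: C eq)
    moreover have "(t, c mod k) \<in> ?T" using t(1) assms(3) by simp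
    ultimately show "C \<in> ?coset ` ?T" by blast
  qed (auto intro!: flat.rcosetsI)
  ultimately show ?thesis
    using card_box[of a d] assms
    by (simp add: has_index_def card_image card_cartesian_product nat_mult_distrib mult.commute)
qed

text \<open>Finite index puts positive powers of the translations 1 and zeta and of z into
  \<open>K\<close>, so its translations have rank two and its projection to Z is nonzero. Stability
  follows by comparing (x, c) (u, 0) with (x, c), both in \<open>K\<close>.\<close>

lemma finite_index_subgroup_eq_lift:
  assumes K: "subgroup K flat_model" and fin: "finite (rcosets\<^bsub>flat_model\<^esub> K)"
  obtains a b d k v where "a > 0" "0 \<le> b" "b < a" "d > 0" "k > 0" "v \<in> box a d"
    "zeta_pow_stable k (hnf a b d)" "K = lift_lattice (hnf a b d) k v"
proof -
  have mult: "x \<otimes>\<^bsub>flat_model\<^esub> y \<in> K" if "x \<in> K" "y \<in> K" for x y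
    using K that by (rule subgroup.m_closed)
  have inv: "inv\<^bsub>flat_model\<^esub> x \<in> K" if "x \<in> K" for x
    using K that by (rule subgroup.m_inv_closed)
  have one: "(0, 0) \<in> K" using subgroup.one_closed[OF K] by simp
  have pow: "\<exists>n::int. n > 0 \<and> g [^]\<^bsub>flat_model\<^esub> n \<in> K" for g
    using flat.finite_index_pow_mem[OF K fin] by simp
  obtain a0 d0 c0 :: int where pos: "a0 > 0" "d0 > 0" "c0 > 0"
    and mem: "(1, 0) [^]\<^bsub>flat_model\<^esub> a0 \<in> K" "(zeta, 0) [^]\<^bsub>flat_model\<^esub> d0 \<in> K" "(0, 1) [^]\<^bsub>flat_model\<^esub> c0 \<in> K"
    using pow by meson
  define L where "L = {u. (u, 0) \<in> K}"
  have diff: "(u - zeta_pow (c - c') * t, c - c') \<in> K" if "(u, c) \<in> K" "(t, c') \<in> K" for u c t c'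
    using mult[OF that(1) inv[OF that(2)]] zeta_pow_add[of c "- c'"] by (simp add: inv_flat_model mult.assoc)
  have L: "add_closed L"
    using one diff[of _ 0 _ 0] by (auto simp: add_closed_def L_def)
  have "of_int a0 * 1 = Eis a0 0" "of_int d0 * zeta = Eis 0 d0" by (simp_all add: eis_eq_iff zeta_def)
  then have "Eis a0 0 \<in> L" "Eis 0 d0 \<in> L" using mem unfolding flat_int_pow by (simp_all add: L_def)
  then obtain a b d where h: "a > 0" "0 \<le> b" "b < a" "d > 0" "L = hnf a b d"
    using hnf_exists[OF L] pos by blast
  have "\<exists>k>0. snd ` K = {c. k dvd c}"
  proof (rule int_subgroup_generated)
    show "x - y \<in> snd ` K" if xy: "x \<in> snd ` K" "y \<in> snd ` K" for x y
    proof -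
      obtain u t where "(u, x) \<in> K" "(t, y) \<in> K"
        using xy by auto
      from diff[OF this] show ?thesis by (metis imageI snd_conv)
    qed
    show "c0 \<in> snd ` K" using imageI[OF mem(3), of snd] unfolding flat_int_pow by simp
  qed (rule pos)
  then obtain k where k: "k > 0" "snd ` K = {c. k dvd c}" by blast
  then have "k \<in> snd ` K" by simp
  then obtain v0 where v0: "(v0, k) \<in> K" by (metis imageE prod.collapse)
  obtain v where v: "v \<in> box a d" "v0 - v \<in> L" using box_exists h by blast
  \<comment> \<open>Multiplying by a translation in \<open>L\<close> replaces \<open>v0\<close> by
    its representative in the box.\<close>
  have "v - v0 \<in> L" using add_closedD(3)[OF L v(2)] by simp
  then have vk: "(v, k) \<in> K" using mult[OF _ v0, of "(v - v0, 0)"] by (simp add: L_def)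
  have tw: "(twist k v j, k * j) \<in> K" for j
    using flat.subgroup_int_pow_closed[OF K vk, of j] by (simp add: flat_int_pow_eq)
  have "zeta_pow_stable k L"
    unfolding zeta_pow_stable_def
  proof (intro allI impI)
    fix c u assume "k dvd c" "u \<in> L"
    then have "c \<in> snd ` K" using k(2) by blast
    then obtain x where "(x, c) \<in> K" by (metis imageE prod.collapse)
    with \<open>u \<in> L\<close> have "(x + zeta_pow c * u, c) \<in> K" using mult[of "(x, c)" "(u, 0)"] by (simp add: L_def)
    from diff[OF this \<open>(x, c) \<in> K\<close>] show "zeta_pow c * u \<in> L" by (simp add: L_def)
  qed
  moreover have "(u, c) \<in> K \<longleftrightarrow> (u, c) \<in> lift_lattice L k v" for u c
  proof -
    have dvd: "k dvd c" if "(u, c) \<in> K" using k(2) imageI[OF that, of snd] by simp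
    have iff: "(u, k * j) \<in> K \<longleftrightarrow> u - twist k v j \<in> L" for j
    proof
      assume "(u, k * j) \<in> K"
      from diff[OF this tw[of j]] show "u - twist k v j \<in> L" by (simp add: L_def)
    next
      assume "u - twist k v j \<in> L"
      then have "(u - twist k v j, 0) \<in> K" by (simp add: L_def)
      from mult[OF this tw[of j]] show "(u, k * j) \<in> K" by simp
    qed
    show ?thesis
    proof (cases "k dvd c")
      case True
      then show ?thesis using iff mem_lift_lattice[OF k(1)] by auto
    next
      case False
      then show ?thesis using dvd by (auto simp: lift_lattice_def)
    qed
  qed
  then have "K = lift_lattice L k v" by auto
  ultimately show ?thesis using that h k(1) v(1) by blast
qed

text \<open>\<open>L\<close> is the translation part of the lift, \<open>k\<close> generates its
  projection to Z, and over \<open>k\<close> the lift is a single class modulo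
  \<open>L\<close>.\<close>

lemma lift_lattice_inject:
  assumes "k > 0" "k' > 0" "add_closed L" "add_closed L'" "lift_lattice L k v = lift_lattice L' k' v'"
  shows "L = L' \<and> k = k' \<and> v - v' \<in> L"
proof -
  have "L = {u. (u, 0) \<in> lift_lattice L k v}" for L k v by (simp add: lift_lattice_def)
  then have L: "L = L'" using assms(5) by metis
  have "snd ` lift_lattice L k v = {c. k dvd c}" if "add_closed L" "k > 0" for L k v
  proof (intro equalityI subsetI)
    fix c assume "c \<in> {c. k dvd c}"
    then obtain j where "c = k * j" by auto
    then have "(twist k v j, c) \<in> lift_lattice L k v"
      using add_closedD(1)[OF that(1)] that(2) by (simp add: mem_lift_lattice)
    then show "c \<in> snd ` lift_lattice L k v" by (metis imageI snd_conv)
  qed (auto simp: lift_lattice_def)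
  then have k: "k = k'" using dvd_set_eqD assms by metis
  have "(v, k * 1) \<in> lift_lattice L k v"
    unfolding mem_lift_lattice[OF assms(1)] using add_closedD(1)[OF assms(3)] by simp
  then have "v - v' \<in> L" using assms(1,5) L k mem_lift_lattice[of k v 1 L v'] by simp
  with L k show ?thesis by blast
qed

section \<open>Isomorphism types\<close>

definition zeta_closed :: "eis set \<Rightarrow> bool" where
  "zeta_closed L \<longleftrightarrow> (\<forall>u\<in>L. zeta * u \<in> L)"

lemma zeta_pow_stable_iff:
  "zeta_pow_stable k L \<longleftrightarrow> 3 dvd k \<or> zeta_closed L"
proof
  assume st: "zeta_pow_stable k L"
  show "3 dvd k \<or> zeta_closed L"
  proof (rule disjCI)
    assume "\<not> zeta_closed L"
    show "3 dvd k"
    proof (rule ccontr)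
      assume "\<not> 3 dvd k"
      \<comment> \<open>If \<open>k\<close> is 2 modulo 3, then \<open>2 * k\<close> is 1 modulo 3;
        in either case a multiple of \<open>k\<close> acts as zeta itself.\<close>
      then have "k mod 3 = 1 \<or> (2 * k) mod 3 = 1" by presburger
      then have "zeta_pow k = zeta \<or> zeta_pow (2 * k) = zeta" by (auto simp: zeta_pow_def)
      then have "zeta_closed L"
        using st unfolding zeta_pow_stable_def zeta_closed_def by (metis dvd_refl dvd_triv_right)
      with \<open>\<not> zeta_closed L\<close> show False ..
    qed
  qed
next
  assume "3 dvd k \<or> zeta_closed L"
  then show "zeta_pow_stable k L"
  proof
    assume "3 dvd k"
    then have "zeta_pow c = 1" if "k dvd c" for c
      using that by (metis dvd_eq_mod_eq_0 dvd_trans zeta_pow_def)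
    then show ?thesis by (simp add: zeta_pow_stable_def)
  next
    assume "zeta_closed L"
    then show ?thesis by (auto simp: zeta_pow_stable_def zeta_closed_def zeta_pow_def mult.assoc)
  qed
qed

text \<open>It is enough to test the basis: zeta a has coordinates (0, a), and zeta (b + d zeta) has
  coordinates (-d, b - d). Membership of the former makes \<open>d\<close> divide \<open>a\<close>,
  that of the latter makes \<open>d\<close> divide \<open>b\<close>, and dividing by
  \<open>d\<close> leaves the norm of b' + zeta.\<close>

lemma zeta_closed_hnf_iff:
  assumes "a > 0" "d > 0"
  shows "zeta_closed (hnf a b d) \<longleftrightarrow> (\<exists>a' b'. a = d * a' \<and> b = d * b' \<and> a' dvd b'\<^sup>2 - b' + 1)"
proof
  assume z: "zeta_closed (hnf a b d)"
  have "Eis a 0 \<in> hnf a b d" "Eis b d \<in> hnf a b d"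
    using assms(2) by (simp_all add: hnf_def)
  then have "zeta * Eis a 0 \<in> hnf a b d" "zeta * Eis b d \<in> hnf a b d"
    using z unfolding zeta_closed_def by blast+
  then have 1: "d dvd a" "a dvd b * (a div d)" "d dvd b - d" "a dvd - d - b * ((b - d) div d)"
    by (simp_all add: hnf_def zeta_def)
  then obtain a' where a': "a = d * a'" by blast
  have "d dvd b" using 1(3) dvd_add[OF 1(3) dvd_refl] by simp
  then obtain b' where b': "b = d * b'" by blast
  have "(b - d) div d = b' - 1"
    using assms(2) by (metis b' mult.right_neutral nonzero_mult_div_cancel_left order_less_irrefl right_diff_distrib)
  then have "a dvd - d - b * (b' - 1)" using 1(4) by simp
  also have "- d - b * (b' - 1) = - (d * (b'\<^sup>2 - b' + 1))"
    by (simp add: b' power2_eq_square algebra_simps)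
  finally have "d * a' dvd - (d * (b'\<^sup>2 - b' + 1))" unfolding a' .
  then have "a' dvd b'\<^sup>2 - b' + 1" using assms(2) by simp
  with a' b' show "\<exists>a' b'. a = d * a' \<and> b = d * b' \<and> a' dvd b'\<^sup>2 - b' + 1" by blast
next
  assume "\<exists>a' b'. a = d * a' \<and> b = d * b' \<and> a' dvd b'\<^sup>2 - b' + 1"
  then obtain a' b' e where h: "a = d * a'" "b = d * b'" "b'\<^sup>2 - b' + 1 = a' * e" by (auto elim!: dvdE)
  show "zeta_closed (hnf a b d)"
    unfolding zeta_closed_def
  proof
    fix u assume "u \<in> hnf a b d"
    then obtain p q where u: "u = Eis (p * a + q * b) (q * d)" using hnf_iff[OF assms(2)] by blast
    \<comment> \<open>The coordinate of \<open>zeta * u\<close> along the second basis vector,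
      forced by its zeta-coordinate; the other coefficient, with \<open>e\<close> the cofactor of
      \<open>a'\<close>, is forced by the real coordinate.\<close>
    define r where "r = p * a' + q * b' - q"
    have "- (q * d) = (- (p * b') - q * e) * a + r * b"
    proof -
      have "(- (p * b') - q * e) * a + r * b = - (q * d * (a' * e)) + d * (q * b' * b' - q * b')"
        by (simp add: h(1,2) r_def algebra_simps)
      also have "\<dots> = - (q * d)" by (simp add: h(3)[symmetric] power2_eq_square algebra_simps)
      finally show ?thesis by simp
    qed
    then have "zeta * u = Eis ((- (p * b') - q * e) * a + r * b) (r * d)"
      by (simp add: u eis_eq_iff zeta_def r_def h(1,2) algebra_simps)
    then show "zeta * u \<in> hnf a b d" using hnf_iff[OF assms(2)] by blast
  qed
qed

section \<open>Norm and principal ideals\<close>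

text \<open>Complex conjugation, which sends zeta to zeta^2 = -1 - zeta.\<close>

definition conj_eis :: "eis \<Rightarrow> eis" where
  "conj_eis u = Eis (er u - ei u) (- ei u)"

text \<open>The squared absolute value of a + b zeta.\<close>

definition norm_eis :: "eis \<Rightarrow> int" where
  "norm_eis u = (er u)\<^sup>2 - er u * ei u + (ei u)\<^sup>2"

lemma conj_eis_simps [simp]:
  "conj_eis (u + v) = conj_eis u + conj_eis v" "conj_eis (u * v) = conj_eis u * conj_eis v"
  "conj_eis (conj_eis u) = u" "conj_eis 1 = 1" "conj_eis 0 = 0"
  by (simp_all add: conj_eis_def eis_eq_iff algebra_simps)

lemma conj_zeta: "conj_eis zeta = zeta * zeta"
  by (simp add: conj_eis_def zeta_def eis_eq_iff)

lemma norm_eis_mult: "norm_eis (u * v) = norm_eis u * norm_eis v"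
  by (simp add: norm_eis_def power2_eq_square algebra_simps)

lemma mult_conj_eis: "u * conj_eis u = of_int (norm_eis u)"
  by (simp add: conj_eis_def norm_eis_def eis_eq_iff power2_eq_square algebra_simps)

lemma norm_conj_eis [simp]: "norm_eis (conj_eis u) = norm_eis u"
  by (simp add: conj_eis_def norm_eis_def power2_eq_square algebra_simps)

lemma four_norm_eis: "4 * norm_eis u = (2 * er u - ei u)\<^sup>2 + 3 * (ei u)\<^sup>2"
  by (simp add: norm_eis_def power2_eq_square algebra_simps)

lemma norm_eis_nonneg: "norm_eis u \<ge> 0"
  using four_norm_eis[of u] zero_le_power2[of "2 * er u - ei u"] zero_le_power2[of "ei u"] by linarith

lemma norm_eis_eq_0_iff: "norm_eis u = 0 \<longleftrightarrow> u = 0"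
proof
  assume "norm_eis u = 0"
  then have "(2 * er u - ei u)\<^sup>2 + 3 * (ei u)\<^sup>2 = 0" using four_norm_eis[of u] by simp
  then have "(2 * er u - ei u)\<^sup>2 = 0 \<and> (ei u)\<^sup>2 = 0"
    using zero_le_power2[of "2 * er u - ei u"] zero_le_power2[of "ei u"] by linarith
  then show "u = 0" by (simp add: eis_eq_iff)
qed (simp add: norm_eis_def)

lemma eis_mult_left_cancel:
  fixes \<alpha> :: eis
  assumes "\<alpha> \<noteq> 0" "\<alpha> * u = \<alpha> * v"
  shows "u = v"
proof -
  have "norm_eis \<alpha> * norm_eis (u - v) = 0"
    using assms(2) by (simp add: norm_eis_mult[symmetric] right_diff_distrib norm_eis_eq_0_iff)
  then show ?thesis using assms(1) by (auto simp: norm_eis_eq_0_iff)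
qed

lemma exists_nearest_int:
  fixes s N :: int
  assumes "N > 0"
  shows "\<exists>q. \<bar>2 * (s - N * q)\<bar> \<le> N"
proof
  have "(2 * s + N) div (2 * N) * (2 * N) + (2 * s + N) mod (2 * N) = 2 * s + N"
    by (rule div_mult_mod_eq)
  moreover have "0 \<le> (2 * s + N) mod (2 * N)" "(2 * s + N) mod (2 * N) < 2 * N" using assms by auto
  \<comment> \<open>The witness is s / N + 1/2 rounded down.\<close>
  ultimately show "\<bar>2 * (s - N * ((2 * s + N) div (2 * N)))\<bar> \<le> N" by (simp add: algebra_simps abs_le_iff)
qed

text \<open>Rounding the coordinates of \<open>u / \<alpha> = u \<alpha>\<^sup>* / N(\<alpha>)\<close> leaves a remainder of norm at most
  \<open>3/4 N(\<alpha>)\<close>.\<close>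

lemma norm_eis_euclid:
  assumes "\<alpha> \<noteq> 0"
  shows "\<exists>q. norm_eis (u - \<alpha> * q) < norm_eis \<alpha>"
proof -
  define N where "N = norm_eis \<alpha>"
  have N: "N > 0" using assms norm_eis_nonneg[of \<alpha>] norm_eis_eq_0_iff[of \<alpha>] by (simp add: N_def)
  define w where "w = u * conj_eis \<alpha>"
  obtain q1 q2 where q: "\<bar>2 * (er w - N * q1)\<bar> \<le> N" "\<bar>2 * (ei w - N * q2)\<bar> \<le> N"
    using exists_nearest_int[OF N] by meson
  \<comment> \<open>The future remainder multiplied by \<open>conj_eis \<alpha>\<close>: this keeps
    all coordinates integral, and its norm carries an extra factor \<open>N\<close> that is
    cancelled at the end.\<close>
  define r where "r = w - of_int N * Eis q1 q2"
  have r: "\<bar>2 * er r\<bar> \<le> N" "\<bar>2 * ei r\<bar> \<le> N" using q by (simp_all add: r_def)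
  have "(2 * er r)\<^sup>2 \<le> N\<^sup>2" "(2 * ei r)\<^sup>2 \<le> N\<^sup>2"
    using r N by (metis abs_le_square_iff abs_of_pos)+
  moreover have "\<bar>2 * er r\<bar> * \<bar>2 * ei r\<bar> \<le> N * N" using r N by (intro mult_mono) auto
  then have "- (2 * er r) * (2 * ei r) \<le> N\<^sup>2" by (simp add: power2_eq_square abs_mult[symmetric] abs_le_iff)
  ultimately have "4 * norm_eis r \<le> 3 * N\<^sup>2"
    by (simp add: norm_eis_def power2_eq_square algebra_simps)
  moreover have "N\<^sup>2 > 0" using N by simp
  ultimately have "norm_eis r < N * N" by (simp add: power2_eq_square)
  moreover have "r = (u - \<alpha> * Eis q1 q2) * conj_eis \<alpha>"
    by (simp only: r_def w_def N_def mult_conj_eis[symmetric]) (simp add: algebra_simps)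
  then have "norm_eis r = norm_eis (u - \<alpha> * Eis q1 q2) * N" by (simp add: norm_eis_mult N_def)
  ultimately have "norm_eis (u - \<alpha> * Eis q1 q2) < N" using N by simp
  then show ?thesis unfolding N_def by blast
qed

text \<open>Since 1 and zeta span the ring over Z, an additive subgroup stable under zeta is an
  ideal.\<close>

lemma zeta_closed_mult:
  assumes L: "add_closed L" "zeta_closed L" and u: "u \<in> L"
  shows "u * q \<in> L"
proof -
  have "u * q = of_int (er q) * u + of_int (ei q) * (zeta * u)"
    by (simp add: eis_eq_iff zeta_def algebra_simps)
  moreover have "zeta * u \<in> L" using L(2) u by (simp add: zeta_closed_def)
  ultimately show ?thesis
    using add_closedD(4)[OF L(1)] add_closed_of_int_mult[OF L(1)] u by simp
qed

text \<open>A nonzero element of least norm generates, by division with remainder.\<close>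

lemma zeta_closed_principal:
  assumes L: "add_closed L" "zeta_closed L" and "u0 \<in> L" "u0 \<noteq> 0"
  shows "\<exists>\<alpha>. \<alpha> \<noteq> 0 \<and> L = range (\<lambda>q. \<alpha> * q)"
proof -
  obtain \<alpha> where \<alpha>: "\<alpha> \<in> L" "\<alpha> \<noteq> 0" "\<And>u. u \<in> L \<Longrightarrow> u \<noteq> 0 \<Longrightarrow> nat (norm_eis \<alpha>) \<le> nat (norm_eis u)"
    using exists_least_iff[of "\<lambda>m. \<exists>u\<in>L. u \<noteq> 0 \<and> nat (norm_eis u) = m"] assms(3,4) by (metis not_le)
  have "u \<in> range (\<lambda>q. \<alpha> * q)" if "u \<in> L" for u
  proof -
    obtain q where q: "norm_eis (u - \<alpha> * q) < norm_eis \<alpha>" using norm_eis_euclid[OF \<alpha>(2)] by blast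
    have "u - \<alpha> * q \<in> L" using add_closedD(2)[OF L(1) that] zeta_closed_mult[OF L \<alpha>(1)] by blast
    then have "u - \<alpha> * q = 0"
      using \<alpha>(3) q norm_eis_nonneg[of "u - \<alpha> * q"] by fastforce
    then show ?thesis by auto
  qed
  then show ?thesis using \<alpha>(1,2) zeta_closed_mult[OF L] by blast
qed

section \<open>Explicit isomorphisms\<close>

text \<open>All powers of zeta involved equal 1, so \<open>twist\<close> is linear in
  \<open>j\<close>, and the two lattice vectors together with (v, k) form a free abelian
  basis.\<close>

lemma lift_lattice_iso_Z_cubed:
  assumes "a > 0" "d > 0" "k > 0" "3 dvd k"
  shows "flat_model\<lparr>carrier := lift_lattice (hnf a b d) k v\<rparr> \<cong> Z_cubed"
proof -
  let ?K = "lift_lattice (hnf a b d) k v"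
  have zp: "zeta_pow (k * j) = 1" for j using assms(4) by (simp add: zeta_pow_def mod_eq_0_iff_dvd)
  have tw: "twist k v j = of_int j * v" for j
    using flat.int_pow_unique[of "\<lambda>j. (of_int j * v, k * j)" j]
    by (simp add: zp flat_int_pow_eq distrib_left distrib_right)
  define f where "f = (\<lambda>(p, q, j). (of_int p * Eis a 0 + of_int q * Eis b d + of_int j * v, k * j))"
  have "f \<in> iso Z_cubed (flat_model\<lparr>carrier := ?K\<rparr>)"
  proof (rule isoI)
    have mem: "f x \<in> ?K" for x
    proof (cases x)
      case (fields p q j)
      have "of_int p * Eis a 0 + of_int q * Eis b d = Eis (p * a + q * b) (q * d)"
        by (simp add: eis_eq_iff)
      then show ?thesis using assms(3) hnf_iff[OF assms(2)]
        by (auto simp: fields f_def mem_lift_lattice tw)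
    qed
    then show "f \<in> hom Z_cubed (flat_model\<lparr>carrier := ?K\<rparr>)"
    proof (intro homI)
      fix x y :: "int \<times> int \<times> int"
      obtain p q j p' q' j' where "x = (p, q, j)" "y = (p', q', j')" by (metis prod_cases3)
      then show "f (x \<otimes>\<^bsub>Z_cubed\<^esub> y) = f x \<otimes>\<^bsub>flat_model\<lparr>carrier := ?K\<rparr>\<^esub> f y"
        by (simp add: Z_cubed_def f_def zp) (simp add: algebra_simps)
    qed simp
    have "inj f"
    proof (rule injI)
      fix x y assume "f x = f y"
      moreover obtain p q j where x: "x = (p, q, j)" by (cases x)
      moreover obtain p' q' j' where y: "y = (p', q', j')" by (cases y)
      ultimately have "j = j'" "p * a + q * b = p' * a + q' * b" "q * d = q' * d"
        using assms(3) by (auto simp: f_def eis_eq_iff)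
      then show "x = y" using assms(1,2) by (simp add: x y)
    qed
    moreover have "?K \<subseteq> range f"
    proof
      fix x assume x: "x \<in> ?K"
      then obtain u j where uj: "x = (u, k * j)" by (cases x) (auto simp: lift_lattice_def elim!: dvdE)
      then have "u - twist k v j \<in> hnf a b d" using x mem_lift_lattice[OF assms(3)] by simp
      then obtain p q where "u - twist k v j = Eis (p * a + q * b) (q * d)" using hnf_iff[OF assms(2)] by blast
      then have "u = Eis (p * a + q * b) (q * d) + of_int j * v" by (simp add: tw diff_eq_eq)
      then have "x = f (p, q, j)" by (simp add: f_def uj eis_eq_iff)
      then show "x \<in> range f" by blast
    qed
    ultimately show "bij_betw f (carrier Z_cubed) (carrier (flat_model\<lparr>carrier := ?K\<rparr>))"
      using mem by (auto simp: bij_betw_def Z_cubed_def)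
  qed
  moreover have "group Z_cubed" by (simp add: Z_cubed_def DirProd_group)
  ultimately show ?thesis using group.iso_sym is_isoI by blast
qed

text \<open>With L generated by \<alpha>, multiplication by \<alpha> identifies Z[zeta] with L, and
  z goes to (v, k). That element acts by zeta^k, so Z[zeta] must be precomposed with a ring
  automorphism taking zeta to zeta^k.\<close>

lemma lift_lattice_iso_flat_model:
  assumes "a > 0" "d > 0" "k > 0" "\<not> 3 dvd k" and z: "zeta_closed (hnf a b d)"
  shows "flat_model\<lparr>carrier := lift_lattice (hnf a b d) k v\<rparr> \<cong> flat_model"
proof -
  let ?L = "hnf a b d" and ?K = "lift_lattice (hnf a b d) k v"
  have L: "add_closed ?L" using assms(2) by (rule add_closed_hnf)
  have "Eis a 0 \<in> ?L" "Eis a 0 \<noteq> 0" using assms(1) by (simp_all add: hnf_def eis_eq_iff)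
  then obtain \<alpha> where \<alpha>: "\<alpha> \<noteq> 0" "?L = range (\<lambda>q. \<alpha> * q)" using zeta_closed_principal[OF L z] by blast
  \<comment> \<open>Only the identity and conjugation are available; as 3 does not divide
    \<open>k\<close>, zeta^k is zeta or its conjugate, so they suffice.\<close>
  define \<tau> where "\<tau> = (if k mod 3 = 1 then id else conj_eis)"
  have \<tau>: "\<tau> (u + w) = \<tau> u + \<tau> w" "\<tau> (u * w) = \<tau> u * \<tau> w" "\<tau> (\<tau> u) = u" for u w
    by (simp_all add: \<tau>_def)
  have \<tau>_zeta: "\<tau> (zeta_pow c) = zeta_pow (k * c)" for c
  proof (cases "k mod 3 = 1")
    case True
    then have "(k * c) mod 3 = c mod 3" by (metis mod_mult_left_eq mult_1)
    with True show ?thesis by (simp add: \<tau>_def zeta_pow_def)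
  next
    case False
    then have "k mod 3 = 2" using assms(4) by presburger
    then have "(k * c) mod 3 = (2 * c) mod 3" by (metis mod_mult_left_eq)
    moreover have "c mod 3 = 0 \<and> (2 * c) mod 3 = 0 \<or> c mod 3 = 1 \<and> (2 * c) mod 3 = 2 \<or>
        c mod 3 = 2 \<and> (2 * c) mod 3 = 1" by presburger
    moreover have "zeta * zeta * (zeta * zeta) = zeta" by (simp add: eis_eq_iff zeta_def)
    ultimately show ?thesis using False
      by (elim disjE conjE) (simp_all add: \<tau>_def zeta_pow_def conj_zeta)
  qed
  define f where "f = (\<lambda>(u, c). (\<alpha> * \<tau> u + twist k v c, k * c))"
  have "f \<in> iso flat_model (flat_model\<lparr>carrier := ?K\<rparr>)"
  proof (rule isoI)
    have mem: "f x \<in> ?K" for x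
      using assms(3) by (cases x) (simp add: f_def mem_lift_lattice \<alpha>(2))
    then show "f \<in> hom flat_model (flat_model\<lparr>carrier := ?K\<rparr>)"
      by (intro homI) (auto simp: f_def \<tau> \<tau>_zeta twist_add algebra_simps)
    have "inj f"
    proof (rule injI)
      fix x y assume "f x = f y"
      moreover obtain u c where x: "x = (u, c)" by (cases x)
      moreover obtain w e where y: "y = (w, e)" by (cases y)
      ultimately have "c = e" "\<alpha> * \<tau> u = \<alpha> * \<tau> w" using assms(3) by (auto simp: f_def)
      then have "\<tau> (\<tau> u) = \<tau> (\<tau> w)" using eis_mult_left_cancel[OF \<alpha>(1)] by metis
      then show "x = y" unfolding \<tau>(3) using x y \<open>c = e\<close> by simp
    qed
    moreover have "?K \<subseteq> range f"
    proof
      fix x assume x: "x \<in> ?K"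
      then obtain u j where uj: "x = (u, k * j)" by (cases x) (auto simp: lift_lattice_def elim!: dvdE)
      then have "u - twist k v j \<in> ?L" using x mem_lift_lattice[OF assms(3)] by simp
      then obtain q where "u - twist k v j = \<alpha> * q" using \<alpha>(2) by blast
      then have "x = f (\<tau> q, j)" by (simp add: f_def uj \<tau> diff_eq_eq)
      then show "x \<in> range f" by blast
    qed
    ultimately show "bij_betw f (carrier flat_model) (carrier (flat_model\<lparr>carrier := ?K\<rparr>))"
      using mem by (auto simp: bij_betw_def)
  qed
  then show ?thesis using group.iso_sym[OF group_flat_model] is_isoI by blast
qed

text \<open>The translation by 1 and z do not commute. This keeps the two families of subgroups
  disjoint.\<close>

lemma flat_model_not_iso_Z_cubed: "\<not> flat_model \<cong> Z_cubed"
proof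
  assume "flat_model \<cong> Z_cubed"
  then have "Z_cubed \<cong> flat_model" by (rule group.iso_sym[OF group_flat_model])
  moreover have "comm_group Z_cubed"
    by (rule group.group_comm_groupI) (auto simp: Z_cubed_def DirProd_group)
  ultimately have "comm_group flat_model"
    using comm_group.iso_imp_comm_group group_flat_model group.is_monoid by blast
  then have "(1, 0) \<otimes>\<^bsub>flat_model\<^esub> (0, 1) = (0, 1) \<otimes>\<^bsub>flat_model\<^esub> (1, 0)"
    by (intro comm_monoid.m_comm) (auto simp: comm_group_def)
  then show False by (simp add: eis_eq_iff zeta_def)
qed

section \<open>Counting\<close>

definition hnf_params :: "nat \<Rightarrow> (int \<times> int \<times> int) set" where
  "hnf_params m = {(a, b, d). a > 0 \<and> 0 \<le> b \<and> b < a \<and> d > 0 \<and> a * d = int m}"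

text \<open>Each divisor \<open>a\<close> of \<open>m\<close> fixes \<open>d\<close> and leaves
  \<open>a\<close> choices for \<open>b\<close>; the total is the divisor sum.\<close>

lemma card_hnf_params:
  assumes "m > 0"
  shows "finite (hnf_params m)" "card (hnf_params m) = \<Sum>{a. a dvd m}"
proof -
  let ?S = "SIGMA a:{a. a dvd m}. {0..<int a}"
  have "bij_betw (\<lambda>(a, b). (int a, b, int (m div a))) ?S (hnf_params m)"
  proof (rule bij_betw_byWitness[where f' = "\<lambda>(a, b, d). (nat a, b)"])
    show "(\<lambda>(a, b). (int a, b, int (m div a))) ` ?S \<subseteq> hnf_params m"
      using assms by (auto simp: hnf_params_def dvd_div_eq_0_iff simp flip: of_nat_mult intro!: Nat.gr0I)
    have dvd: "nat a dvd m" and div: "int (m div nat a) = d" if "a > 0" "a * d = int m" for a d :: int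
    proof -
      have "int (nat a) dvd int m" using that by (metis dvd_triv_left int_nat_eq order_less_imp_le)
      then show "nat a dvd m" by (simp only: int_dvd_int_iff)
      have "int (m div nat a) = a * d div a" using that by (simp add: zdiv_int)
      then show "int (m div nat a) = d" using that(1) by simp
    qed
    show "(\<lambda>(a, b, d). (nat a, b)) ` hnf_params m \<subseteq> ?S"
      using dvd by (auto simp: hnf_params_def)
    show "\<forall>x\<in>hnf_params m. (\<lambda>(a, b). (int a, b, int (m div a))) ((\<lambda>(a, b, d). (nat a, b)) x) = x"
      using div by (auto simp: hnf_params_def)
  qed auto
  moreover have "finite ?S" using assms by auto
  ultimately show "finite (hnf_params m)" "card (hnf_params m) = \<Sum>{a. a dvd m}"
    using assms by (auto simp: bij_betw_finite bij_betw_same_card[symmetric])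
qed

definition ideal_params :: "nat \<Rightarrow> (int \<times> int \<times> int) set" where
  "ideal_params m = {(a, b, d). (a, b, d) \<in> hnf_params m \<and> zeta_closed (hnf a b d)}"

text \<open>Pulling out the content \<open>d\<close> leaves a primitive ideal of norm
  \<open>a'\<close> given by a root, and a * d becomes a' d^2.\<close>

lemma mem_ideal_params:
  "(a, b, d) \<in> ideal_params m \<longleftrightarrow> d > 0 \<and> (\<exists>a' b'. a = d * int a' \<and> b = d * b' \<and> a' > 0 \<and>
     b' \<in> root_set a' \<and> int m = int a' * d\<^sup>2)"
proof
  assume h: "(a, b, d) \<in> ideal_params m"
  then have 1: "a > 0" "0 \<le> b" "b < a" "d > 0" "a * d = int m" and "zeta_closed (hnf a b d)"
    by (simp_all add: ideal_params_def hnf_params_def)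
  then obtain a' b' where 2: "a = d * a'" "b = d * b'" "a' dvd b'\<^sup>2 - b' + 1"
    using zeta_closed_hnf_iff by blast
  have 3: "a' > 0" "0 \<le> b'" "b' < a'" using 1 unfolding 2 by (simp_all add: zero_less_mult_iff zero_le_mult_iff)
  have "a = d * int (nat a')" "nat a' > 0" "b' \<in> root_set (nat a')" "int m = int (nat a') * d\<^sup>2"
    using 1 2 3 by (simp_all add: root_set_def power2_eq_square flip: 1(5))
  then show "d > 0 \<and> (\<exists>a' b'. a = d * int a' \<and> b = d * b' \<and> a' > 0 \<and>
     b' \<in> root_set a' \<and> int m = int a' * d\<^sup>2)"
    using 1(4) 2(2) by blast
next
  assume "d > 0 \<and> (\<exists>a' b'. a = d * int a' \<and> b = d * b' \<and> a' > 0 \<and>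
     b' \<in> root_set a' \<and> int m = int a' * d\<^sup>2)"
  then obtain a' b' where h: "d > 0" "a = d * int a'" "b = d * b'" "a' > 0"
    "b' \<in> root_set a'" "int m = int a' * d\<^sup>2" by blast
  have "a > 0" using h by simp
  then have "zeta_closed (hnf a b d)"
    using zeta_closed_hnf_iff h by (auto simp: root_set_def)
  then show "(a, b, d) \<in> ideal_params m"
    using h by (simp add: ideal_params_def hnf_params_def root_set_def power2_eq_square)
qed

text \<open>A triple is recovered from its primitive part: \<open>d\<close> is the positive square
  root of \<open>m div a'\<close>. Counting by \<open>a'\<close> gives the convolution of
  \<open>num_roots\<close> with \<open>square_ind\<close>.\<close>

lemma card_ideal_params:
  assumes "m > 0"
  shows "int (card (ideal_params m)) = (\<Sum>d | d dvd m. Legendre (int d) 3)"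
proof -
  let ?S = "SIGMA a:{a. a dvd m \<and> is_square (m div a)}. root_set a"
  let ?g = "\<lambda>(a, b, d). (nat (a div d), b div d)"
  have "bij_betw ?g (ideal_params m) ?S"
  proof (rule bij_betw_imageI)
    show "inj_on ?g (ideal_params m)"
    proof (rule inj_onI)
      fix x y assume xy: "x \<in> ideal_params m" "y \<in> ideal_params m" "?g x = ?g y"
      obtain a b d a2 b2 d2 where x: "x = (a, b, d)" and y: "y = (a2, b2, d2)" by (metis prod_cases3)
      have eq: "nat (a div d) = nat (a2 div d2)" "b div d = b2 div d2" using xy(3) by (simp_all add: x y)
      have "(a, b, d) \<in> ideal_params m" "(a2, b2, d2) \<in> ideal_params m" using xy x y by auto
      then obtain a' b' a2' b2' where h: "d > 0" "a = d * int a'" "b = d * b'" "a' > 0" "int m = int a' * d\<^sup>2"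
        "d2 > 0" "a2 = d2 * int a2'" "b2 = d2 * b2'" "int m = int a2' * d2\<^sup>2"
        by (auto simp: mem_ideal_params)
      then have "a' = a2'" "b' = b2'" using eq by simp_all
      moreover from this have "d\<^sup>2 = d2\<^sup>2" using h(4,5,9) by simp
      then have "d = d2" using h(1,6) by simp
      ultimately show "x = y" using h by (simp add: x y)
    qed
    show "?g ` ideal_params m = ?S"
    proof (intro equalityI subsetI)
      fix x assume "x \<in> ?g ` ideal_params m"
      then obtain a b d where "(a, b, d) \<in> ideal_params m" "x = ?g (a, b, d)" by auto
      then obtain a' b' where h: "d > 0" "a' > 0" "b' \<in> root_set a'" "int m = int a' * d\<^sup>2" "x = (a', b')"
        by (auto simp: mem_ideal_params)
      have "int m = int (a' * (nat d)\<^sup>2)" using h(1,4) by simp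
      then have "m = a' * (nat d)\<^sup>2" by (simp only: of_nat_eq_iff)
      then show "x \<in> ?S" using h by simp
    next
      fix x assume "x \<in> ?S"
      then obtain a' b' where x: "x = (a', b')" "a' dvd m" "is_square (m div a')" "b' \<in> root_set a'" by auto
      then obtain e where "m div a' = e\<^sup>2" by (auto elim: is_nth_powerE)
      then have m: "m = a' * e\<^sup>2" using x(2) by (metis dvd_mult_div_cancel)
      have pos: "a' > 0" "e > 0" using assms by (auto simp: m)
      then have mem: "(int e * int a', int e * b', int e) \<in> ideal_params m"
        unfolding mem_ideal_params using x(4) m pos by (intro conjI exI[of _ a'] exI[of _ b']) simp_all
      have "x = ?g (int e * int a', int e * b', int e)" using pos by (simp add: x(1))
      then show "x \<in> ?g ` ideal_params m" using mem by (rule image_eqI)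
    qed
  qed
  then have "int (card (ideal_params m)) = int (card ?S)" by (simp add: bij_betw_same_card)
  also have "card ?S = (\<Sum>a | a dvd m \<and> is_square (m div a). card (root_set a))"
    using assms by (intro card_SigmaI) (auto simp: finite_root_set)
  also have "int \<dots> = dirichlet_conv num_roots square_ind m"
    using assms by (simp add: dirichlet_conv_def num_roots_def square_ind_def sum.inter_filter[symmetric]
        of_bool_def if_distrib cong: if_cong)
  finally show ?thesis using dirichlet_conv_num_roots_square[OF assms] by simp
qed

section \<open>Parametrised families of subgroups\<close>

text \<open>\<open>m\<close> is the index of the lattice, which leaves n / m for the generator k.
  \<open>P\<close> selects all lattices or only the ideals, and \<open>M\<close> encodes whether 3
  divides k.\<close>

definition lift_params ::
    "(nat \<Rightarrow> (int \<times> int \<times> int) set) \<Rightarrow> nat set \<Rightarrow> (nat \<times> (int \<times> int \<times> int) \<times> eis) set" where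
  "lift_params P M = (SIGMA m:M. SIGMA p:P m. case p of (a, b, d) \<Rightarrow> box a d)"

fun param_subgroup :: "nat \<Rightarrow> nat \<times> (int \<times> int \<times> int) \<times> eis \<Rightarrow> (eis \<times> int) set" where
  "param_subgroup n (m, (a, b, d), v) = lift_lattice (hnf a b d) (int (n div m)) v"

lemma card_lift_params:
  assumes "finite M" "\<And>m. m \<in> M \<Longrightarrow> P m \<subseteq> hnf_params m" "0 \<notin> M"
  shows "finite (lift_params P M)" "card (lift_params P M) = (\<Sum>m\<in>M. m * card (P m))"
proof -
  let ?B = "\<lambda>p. case p of (a, b, d) \<Rightarrow> box a d"
  have finP: "finite (P m)" if "m \<in> M" for m
  proof -
    have "m > 0" using assms(3) that by (cases m) auto
    then show ?thesis using finite_subset[OF assms(2)[OF that]] card_hnf_params(1) by blast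
  qed
  have box: "finite (?B p)" "card (?B p) = m" if "m \<in> M" "p \<in> P m" for m p
  proof -
    obtain a b d where p: "p = (a, b, d)" by (cases p)
    then have "a > 0" "d > 0" "a * d = int m"
      using assms(2) that by (auto simp: hnf_params_def)
    then show "finite (?B p)" "card (?B p) = m" using card_box[of a d] by (simp_all add: p)
  qed
  show "finite (lift_params P M)"
    unfolding lift_params_def using assms(1) finP box(1) by (intro finite_SigmaI) auto
  have "card (lift_params P M) = (\<Sum>m\<in>M. \<Sum>p\<in>P m. card (?B p))"
    unfolding lift_params_def using assms(1) finP box(1)
    by (subst card_SigmaI) (auto intro!: sum.cong card_SigmaI)
  also have "\<dots> = (\<Sum>m\<in>M. m * card (P m))"
    by (intro sum.cong HOL.refl) (simp add: box(2))
  finally show "card (lift_params P M) = (\<Sum>m\<in>M. m * card (P m))" .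
qed

text \<open>Subgroup determines lattice and class of \<open>v\<close>; uniqueness of the Hermite
  form and of box representatives turns these into equal parameters.\<close>

lemma inj_on_param_subgroup:
  assumes "n > 0" "\<And>m. m \<in> M \<Longrightarrow> m dvd n" "\<And>m. P m \<subseteq> hnf_params m"
  shows "inj_on (param_subgroup n) (lift_params P M)"
proof (rule inj_onI)
  fix x y assume xy: "x \<in> lift_params P M" "y \<in> lift_params P M" "param_subgroup n x = param_subgroup n y"
  obtain m a b d v where x: "x = (m, (a, b, d), v)" by (metis prod_cases3 surj_pair)
  obtain m' a' b' d' v' where y: "y = (m', (a', b', d'), v')" by (metis prod_cases3 surj_pair)
  have hx: "m dvd n" "(a, b, d) \<in> hnf_params m" "v \<in> box a d"
    using xy(1) assms(2,3) by (auto simp: x lift_params_def)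
  have hy: "m' dvd n" "(a', b', d') \<in> hnf_params m'" "v' \<in> box a' d'"
    using xy(2) assms(2,3) by (auto simp: y lift_params_def)
  have pos: "int (n div m) > 0" "int (n div m') > 0"
    using hx(1) hy(1) assms(1) by (auto simp: dvd_div_eq_0_iff intro!: Nat.gr0I)
  have hnf: "hnf a b d = hnf a' b' d'" "v - v' \<in> hnf a b d"
    using lift_lattice_inject[OF pos add_closed_hnf add_closed_hnf, of d d'] xy(3) hx(2) hy(2)
    by (auto simp: x y hnf_params_def)
  have eq: "a = a' \<and> b = b' \<and> d = d'"
    by (rule hnf_inject[OF _ _ _ _ _ _ _ _ hnf(1)]) (use hx(2) hy(2) in \<open>simp_all add: hnf_params_def\<close>)
  then have "m = m'" using hx(2) hy(2) by (simp add: hnf_params_def)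
  moreover have "v = v'" using box_unique[OF hx(3) _ hnf(2)] hy(3) eq by simp
  ultimately show "x = y" using eq by (simp add: x y)
qed

lemma subgroup_cases:
  assumes "n > 0" and K: "subgroup K flat_model" "has_index flat_model K n"
  obtains (Z) x where "x \<in> lift_params hnf_params {m. 3 * m dvd n}" "K = param_subgroup n x"
  | (G) x where "x \<in> lift_params ideal_params {m. m dvd n \<and> \<not> 3 * m dvd n}" "K = param_subgroup n x"
proof -
  have "finite (rcosets\<^bsub>flat_model\<^esub> K)" using K(2) by (simp add: has_index_def)
  then obtain a b d k v where h: "a > 0" "0 \<le> b" "b < a" "d > 0" "k > 0" "v \<in> box a d"
    and st: "zeta_pow_stable k (hnf a b d)" and Keq: "K = lift_lattice (hnf a b d) k v"
    using finite_index_subgroup_eq_lift[OF K(1)] by metis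
  have "has_index flat_model K (nat (k * (a * d)))"
    unfolding Keq using h(1,4,5) st by (rule has_index_lift_lattice)
  then have "n = nat (k * (a * d))" using K(2) by (simp add: has_index_def)
  then have "n = nat k * nat (a * d)" using h by (simp add: nat_mult_distrib)
  moreover define m where "m = nat (a * d)"
  ultimately have n: "n = nat k * m" by simp
  have m: "m > 0" "int m = a * d" using h by (simp_all add: m_def)
  have kdiv: "int (n div m) = k" using n m(1) h(5) by simp
  have p: "(a, b, d) \<in> hnf_params m" using h m(2) by (simp add: hnf_params_def)
  \<comment> \<open>As n = k m, divisibility of k by 3 becomes a condition on \<open>m\<close>
    alone.\<close>
  have dvd: "3 * m dvd n \<longleftrightarrow> 3 dvd k"
  proof -
    have "3 * m dvd n \<longleftrightarrow> 3 dvd nat k" using m(1) by (simp add: n)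
    also have "\<dots> \<longleftrightarrow> 3 dvd k" using h(5) by (metis int_dvd_int_iff int_nat_eq of_nat_numeral order_less_imp_le)
    finally show ?thesis .
  qed
  have Keq': "K = param_subgroup n (m, (a, b, d), v)" by (simp add: Keq kdiv)
  show thesis
  proof (cases "3 dvd k")
    case True
    then show ?thesis using Z[OF _ Keq'] p h(6) dvd by (simp add: lift_params_def)
  next
    case False
    then have "zeta_closed (hnf a b d)" using st by (simp add: zeta_pow_stable_iff)
    then show ?thesis using G[OF _ Keq'] p h(6) dvd False n by (simp add: lift_params_def ideal_params_def)
  qed
qed

lemma param_subgroup_subgroup:
  assumes "n > 0" "(m, (a, b, d), v) \<in> lift_params hnf_params {m. m dvd n}"
    and "3 * m dvd n \<or> zeta_closed (hnf a b d)"
  shows "subgroup (param_subgroup n (m, (a, b, d), v)) flat_model"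
    "has_index flat_model (param_subgroup n (m, (a, b, d), v)) n"
    "3 * m dvd n \<Longrightarrow> flat_model\<lparr>carrier := param_subgroup n (m, (a, b, d), v)\<rparr> \<cong> Z_cubed"
    "\<not> 3 * m dvd n \<Longrightarrow> flat_model\<lparr>carrier := param_subgroup n (m, (a, b, d), v)\<rparr> \<cong> flat_model"
proof -
  have h: "a > 0" "d > 0" "a * d = int m" "m dvd n"
    using assms(2) by (auto simp: lift_params_def hnf_params_def)
  obtain k where k: "n = m * k" using h(4) by blast
  have m: "m > 0" "k > 0" using assms(1) k by auto
  have kd: "int (n div m) = int k" using m by (simp add: k)
  have dvd: "3 * m dvd n \<longleftrightarrow> 3 dvd int k"
    using m by (simp add: k mult.commute[of m] int_dvd_int_iff[of 3, simplified])
  have st: "zeta_pow_stable (int k) (hnf a b d)"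
    using assms(3) dvd by (simp add: zeta_pow_stable_iff)
  have nk: "nat (int k * (a * d)) = n" unfolding h(3) k by (simp add: nat_mult_distrib)
  show "subgroup (param_subgroup n (m, (a, b, d), v)) flat_model"
    using subgroup_lift_lattice[OF add_closed_hnf[OF h(2)] st] m by (simp add: kd)
  show "has_index flat_model (param_subgroup n (m, (a, b, d), v)) n"
    using has_index_lift_lattice[OF h(1,2) _ st, of v] m by (simp add: kd nk)
  show "3 * m dvd n \<Longrightarrow> flat_model\<lparr>carrier := param_subgroup n (m, (a, b, d), v)\<rparr> \<cong> Z_cubed"
    using lift_lattice_iso_Z_cubed[OF h(1,2), of "int k"] m dvd by (simp add: kd)
  show "\<not> 3 * m dvd n \<Longrightarrow> flat_model\<lparr>carrier := param_subgroup n (m, (a, b, d), v)\<rparr> \<cong> flat_model"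
    using lift_lattice_iso_flat_model[OF h(1,2), of "int k"] m dvd assms(3) by (simp add: kd)
qed

lemma not_iso_both:
  assumes "subgroup K flat_model" "flat_model\<lparr>carrier := K\<rparr> \<cong> flat_model"
    "flat_model\<lparr>carrier := K\<rparr> \<cong> Z_cubed"
  shows False
proof -
  have "flat_model \<cong> flat_model\<lparr>carrier := K\<rparr>"
    using subgroup.subgroup_is_group[OF assms(1) group_flat_model] assms(2) by (rule group.iso_sym)
  then show False using assms(3) iso_trans flat_model_not_iso_Z_cubed by blast
qed

lemma Z_params_iso:
  assumes "n > 0" "x \<in> lift_params hnf_params {m. 3 * m dvd n}"
  shows "param_subgroup n x \<in> iso_subgroups Z_cubed flat_model n"
proof -
  obtain m a b d v where x: "x = (m, (a, b, d), v)" by (metis prod_cases3 surj_pair)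
  then have "(m, (a, b, d), v) \<in> lift_params hnf_params {m. m dvd n}" and 3: "3 * m dvd n"
    using assms(2) by (auto simp: lift_params_def dest: dvd_mult_right)
  from param_subgroup_subgroup[OF assms(1) this(1)] 3 show ?thesis by (simp add: x iso_subgroups_def)
qed

lemma G_params_iso:
  assumes "n > 0" "x \<in> lift_params ideal_params {m. m dvd n \<and> \<not> 3 * m dvd n}"
  shows "param_subgroup n x \<in> iso_subgroups flat_model flat_model n"
proof -
  obtain m a b d v where x: "x = (m, (a, b, d), v)" by (metis prod_cases3 surj_pair)
  then have "(m, (a, b, d), v) \<in> lift_params hnf_params {m. m dvd n}" and 3: "\<not> 3 * m dvd n"
    and "zeta_closed (hnf a b d)"
    using assms(2) by (auto simp: lift_params_def ideal_params_def)
  from param_subgroup_subgroup[OF assms(1) this(1)] this show ?thesis by (simp add: x iso_subgroups_def)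
qed

text \<open>Every subgroup of index \<open>n\<close> lies in one of the two families, and membership
  in the other one would make the model isomorphic to Z^3.\<close>

lemma iso_subgroups_Z_cubed:
  assumes "n > 0"
  shows "iso_subgroups Z_cubed flat_model n = param_subgroup n ` lift_params hnf_params {m. 3 * m dvd n}"
proof (intro equalityI subsetI)
  fix K assume K: "K \<in> iso_subgroups Z_cubed flat_model n"
  then have sub: "subgroup K flat_model" "has_index flat_model K n" by (auto simp: iso_subgroups_def)
  show "K \<in> param_subgroup n ` lift_params hnf_params {m. 3 * m dvd n}"
  proof (cases rule: subgroup_cases[OF assms sub])
    case (2 x)
    then show ?thesis using G_params_iso[OF assms] K not_iso_both[OF sub(1)] by (auto simp: iso_subgroups_def)
  qed auto
qed (use Z_params_iso[OF assms] in auto)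

lemma iso_subgroups_flat_model:
  assumes "n > 0"
  shows "iso_subgroups flat_model flat_model n =
    param_subgroup n ` lift_params ideal_params {m. m dvd n \<and> \<not> 3 * m dvd n}"
proof (intro equalityI subsetI)
  fix K assume K: "K \<in> iso_subgroups flat_model flat_model n"
  then have sub: "subgroup K flat_model" "has_index flat_model K n" by (auto simp: iso_subgroups_def)
  show "K \<in> param_subgroup n ` lift_params ideal_params {m. m dvd n \<and> \<not> 3 * m dvd n}"
  proof (cases rule: subgroup_cases[OF assms sub])
    case (1 x)
    then show ?thesis using Z_params_iso[OF assms] K not_iso_both[OF sub(1)] by (auto simp: iso_subgroups_def)
  qed auto
qed (use G_params_iso[OF assms] in auto)

lemma ideal_params_subset: "ideal_params m \<subseteq> hnf_params m"
  by (auto simp: ideal_params_def)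

lemma card_iso_subgroups_Z_cubed:
  assumes "n > 0"
  shows "finite (iso_subgroups Z_cubed flat_model n)"
    "int (card (iso_subgroups Z_cubed flat_model n)) = omega (of_nat n / 3)"
proof -
  let ?M = "{m. 3 * m dvd n}"
  have pos: "m > 0" if "m \<in> ?M" for m using that assms by (auto intro!: Nat.gr0I)
  have fin: "finite ?M" using assms by (auto intro: finite_subset[of _ "{m. m dvd n}"] dest: dvd_mult_right)
  have card: "finite (lift_params hnf_params ?M)"
    "card (lift_params hnf_params ?M) = (\<Sum>m\<in>?M. m * card (hnf_params m))"
    using card_lift_params[OF fin, of hnf_params] pos by auto
  then show "finite (iso_subgroups Z_cubed flat_model n)"
    by (simp add: iso_subgroups_Z_cubed[OF assms])
  have "card (iso_subgroups Z_cubed flat_model n) = (\<Sum>m\<in>?M. m * card (hnf_params m))"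
    unfolding iso_subgroups_Z_cubed[OF assms] card(2)[symmetric]
    by (intro card_image inj_on_param_subgroup assms) (auto dest: dvd_mult_right)
  \<comment> \<open>The factor \<open>m\<close> counts the classes of \<open>v\<close> modulo the
    lattice, and sigma_1(m) counts the lattices.\<close>
  also have "int \<dots> = (\<Sum>m\<in>?M. int m * sigma1 (of_nat m))"
    unfolding of_nat_sum of_nat_mult
    by (intro sum.cong HOL.refl) (simp add: sigma1_def divs_of_nat pos card_hnf_params(2))
  also have "\<dots> = omega (of_nat n / 3)" by (simp add: omega_def divs_div_3[OF assms])
  finally show "int (card (iso_subgroups Z_cubed flat_model n)) = omega (of_nat n / 3)" .
qed

lemma card_iso_subgroups_flat_model:
  assumes "n > 0"
  shows "finite (iso_subgroups flat_model flat_model n)"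
    "int (card (iso_subgroups flat_model flat_model n)) =
         (\<Sum>k\<in>divs (of_nat n). int k * theta (of_nat k))
         - (\<Sum>k\<in>divs (of_nat n / 3). int k * theta (of_nat k))"
proof -
  let ?M = "{m. m dvd n \<and> \<not> 3 * m dvd n}"
  have pos: "m > 0" if "m dvd n" for m using that assms by (auto intro!: Nat.gr0I)
  have fin: "finite {m. m dvd n}" using assms by simp
  have finM: "finite ?M" by (rule finite_subset[OF _ fin]) auto
  have card: "finite (lift_params ideal_params ?M)"
    "card (lift_params ideal_params ?M) = (\<Sum>m\<in>?M. m * card (ideal_params m))"
    using card_lift_params[OF finM, of ideal_params] ideal_params_subset assms by auto
  then show "finite (iso_subgroups flat_model flat_model n)"
    by (simp add: iso_subgroups_flat_model[OF assms])
  have "card (iso_subgroups flat_model flat_model n) = (\<Sum>m\<in>?M. m * card (ideal_params m))"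
    unfolding iso_subgroups_flat_model[OF assms] card(2)[symmetric]
    by (intro card_image inj_on_param_subgroup assms ideal_params_subset) auto
  also have "int \<dots> = (\<Sum>m\<in>?M. int m * theta (of_nat m))"
    unfolding of_nat_sum of_nat_mult
    by (intro sum.cong HOL.refl) (simp add: theta_def divs_of_nat pos card_ideal_params)
  \<comment> \<open>The excluded \<open>m\<close> are themselves divisors of \<open>n\<close>, so
    the sum splits as a genuine difference.\<close>
  also have "?M = {m. m dvd n} - {m. 3 * m dvd n}" by auto
  also have "(\<Sum>m\<in>{m. m dvd n} - {m. 3 * m dvd n}. int m * theta (of_nat m)) =
      (\<Sum>m | m dvd n. int m * theta (of_nat m)) - (\<Sum>m | 3 * m dvd n. int m * theta (of_nat m))"
    by (intro sum_diff fin) (auto dest: dvd_mult_right)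
  finally show "int (card (iso_subgroups flat_model flat_model n)) =
         (\<Sum>k\<in>divs (of_nat n). int k * theta (of_nat k))
         - (\<Sum>k\<in>divs (of_nat n / 3). int k * theta (of_nat k))"
    by (simp add: divs_of_nat divs_div_3 assms)
qed

lemma iso_subgroups_cong:
  assumes "T \<cong> U" "U \<cong> T"
  shows "iso_subgroups T G n = iso_subgroups U G n"
  by (auto simp: iso_subgroups_def intro: iso_trans[OF _ assms(1)] iso_trans[OF _ assms(2)])

theorem theorem1:
  fixes n :: nat
  assumes "n > 0"
  shows "(\<forall>\<Delta>. subgroup \<Delta> pi1_G3 \<and> has_index pi1_G3 \<Delta> n \<longrightarrow>
           pi1_G3\<lparr>carrier := \<Delta>\<rparr> \<cong> pi1_G3 \<or> pi1_G3\<lparr>carrier := \<Delta>\<rparr> \<cong> Z_cubed)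
    \<and> finite (iso_subgroups pi1_G3 pi1_G3 n)
    \<and> int (subgroup_count pi1_G3 pi1_G3 n) =
         (\<Sum>k\<in>divs (of_nat n). int k * theta (of_nat k))
         - (\<Sum>k\<in>divs (of_nat n / 3). int k * theta (of_nat k))
    \<and> finite (iso_subgroups Z_cubed pi1_G3 n)
    \<and> int (subgroup_count Z_cubed pi1_G3 n) = omega (of_nat n / 3)"
proof -
  have iso: "pi1_G3 \<cong> flat_model" using class_value_iso by (rule is_isoI)
  then have iso': "flat_model \<cong> pi1_G3" by (rule group.iso_sym[OF pi1.is_group])
  note bij = bij_betw_iso_subgroups[OF pi1.is_group group_flat_model class_value_iso]
  \<comment> \<open>Here \<open>pi1_G3\<close> is both the ambient group and the isomorphism type;
    the type is replaced here, the ambient group by \<open>bij\<close>.\<close>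
  have eq: "iso_subgroups pi1_G3 pi1_G3 n = iso_subgroups flat_model pi1_G3 n"
    by (rule iso_subgroups_cong[OF iso iso'])
  have "pi1_G3\<lparr>carrier := \<Delta>\<rparr> \<cong> pi1_G3 \<or> pi1_G3\<lparr>carrier := \<Delta>\<rparr> \<cong> Z_cubed"
    if \<Delta>: "subgroup \<Delta> pi1_G3" "has_index pi1_G3 \<Delta> n" for \<Delta>
  proof -
    let ?K = "class_value ` \<Delta>"
    have K: "subgroup ?K flat_model" "pi1_G3\<lparr>carrier := \<Delta>\<rparr> \<cong> flat_model\<lparr>carrier := ?K\<rparr>"
      by (rule iso_restrict_image[OF pi1.is_group group_flat_model class_value_iso \<Delta>(1)])+
    have idx: "has_index flat_model ?K n"
      by (rule has_index_iso_image[OF pi1.is_group group_flat_model class_value_iso \<Delta>])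
    show ?thesis
    proof (cases rule: subgroup_cases[OF assms K(1) idx])
      case (1 x)
      then have "flat_model\<lparr>carrier := ?K\<rparr> \<cong> Z_cubed"
        using Z_params_iso[OF assms] by (auto simp: iso_subgroups_def)
      then show ?thesis using iso_trans[OF K(2)] by blast
    next
      case (2 x)
      then have "flat_model\<lparr>carrier := ?K\<rparr> \<cong> flat_model"
        using G_params_iso[OF assms] by (auto simp: iso_subgroups_def)
      then show ?thesis using iso_trans[OF iso_trans[OF K(2)] iso'] by blast
    qed
  qed
  moreover have "finite (iso_subgroups flat_model pi1_G3 n) \<longleftrightarrow> finite (iso_subgroups flat_model flat_model n)"
    "card (iso_subgroups flat_model pi1_G3 n) = card (iso_subgroups flat_model flat_model n)"
    by (rule bij_betw_finite[OF bij], rule bij_betw_same_card[OF bij])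
  moreover have "finite (iso_subgroups Z_cubed pi1_G3 n) \<longleftrightarrow> finite (iso_subgroups Z_cubed flat_model n)"
    "card (iso_subgroups Z_cubed pi1_G3 n) = card (iso_subgroups Z_cubed flat_model n)"
    by (rule bij_betw_finite[OF bij], rule bij_betw_same_card[OF bij])
  ultimately show ?thesis
    using card_iso_subgroups_Z_cubed[OF assms] card_iso_subgroups_flat_model[OF assms]
    by (simp add: subgroup_count_def eq)
qed

end
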